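(* Let $A$ be a generalized Cartan matrix with associated data $\mathfrak h_{\mathbb R}^*,\Pi,W,\overline C$, let $\mu\in\overline C$, let $H$ be the convex hull of $W\mu$, and let $F$ be a fundamental face of $H$. Then $$W_*(F)=W_{\lambda_*(F)}\quad\text{and}\quad W(F)=W_{\lambda(F)}=W_{\lambda_*(F)}\times W_{\lambda^*(F)}$$ (internal direct product). In particular, $$\lambda_*(F)=\{\alpha\in\Pi\mid r_\alpha\eta=\eta\ \text{for all}\ \eta\in F\}\quad\text{and}\quad\lambda(F)=\{\alpha\in\Pi\mid r_\alpha F=F\}.$$
   Context: Let $A=(a_{ij})_{i,j=1}^m$ be a generalized Cartan matrix (integral, $a_{ii}=2$, $a_{ij}\le 0$ for $i\ne j$, $a_{ij}=0\Rightarrow a_{ji}=0$) of rank $l$. Let $(\mathfrak h_{\mathbb R},\Pi,\Pi^\vee)$ be a realization of $A$ over $\mathbb R$: $\mathfrak h_{\mathbb R}$ is a real vector space of dimension $2m-l$, and $\Pi=\{\alpha_1,\dots,\alpha_m\}\subset\mathfrak h_{\mathbb R}^*$ and $\Pi^\vee=\{\alpha_1^\vee,\dots,\alpha_m^\vee\}\subset\mathfrak h_{\mathbb R}$ are linearly independent with $\langle\alpha_j,\alpha_i^\vee\rangle=a_{ij}$. The Weyl group $W\subset GL(\mathfrak h_{\mathbb R}^* )$ is generated by the reflections $r_{\alpha_i}(\eta)=\eta-\langle\eta,\alpha_i^\vee\rangle\alpha_i$. For $I\subseteq\Pi$, $W_I$ is the subgroup generated by $r_\alpha$, $\alpha\in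 I$. The fundamental chamber is $\overline C=\{\eta\in\mathfrak h_{\mathbb R}^*\mid\langle\eta,\alpha^\vee\rangle\ge 0\ \forall\alpha\in\Pi\}$. Set $J_0=\{\alpha\in\Pi\mid\langle\mu,\alpha^\vee\rangle=0\}$. Connected components of a subset of $\Pi$ are taken in the Dynkin diagram of $A$ (distinct $\alpha,\beta\in\Pi$ are adjacent iff $\langle\alpha,\beta^\vee\rangle\ne 0$). A subset $I\subseteq\Pi$ is $\mu$-connected if no connected component of $I$ is contained in $J_0$ (the empty set is $\mu$-connected). For $\mu$-connected $I$, $I_*=\{\alpha\in J_0\setminus I\mid r_\alpha r_\beta=r_\beta r_\alpha\ \forall\beta\in I\}$. A face of the convex set $H$ is a convex subset $F\subseteq H$ such that every closed line segment in $H$ having a relative interior point in $F$ has both endpoints in $F$ (so $\emptyset$ and $H$ are faces). A face $F$ is fundamental if $F=\emptyset$ or $\operatorname{ri}(F)\cap\overline C\ne\emptyset$ ($\operatorname{ri}$ = relative interior). The nonempty fundamental faces are exactly the sets $F_I=\operatorname{co}(W_I\mu)$ (convex hull) with $I\subseteq\Pi$ $\mu$-connected, and $I$ is uniquely determined by $F_I$. For a fundamental face define: if $F=F_I$ with $I$ $\mu$-connected, $\lambda^*(F)=I$, $\lambda_*(F)=I_*$; if $F=\emptyset$, $\lambda^*(F)=\emptyset$, $\lambda_*(F)=\Pi$. In all cases $\lambda(F)=\lambda_*(F)\cup\lambda^*(F)$. For a face $F$: $W(F)=\{w\in W\mid wF=F\}$ is its isotropy group and $W_*(F)=\{w\in W\mid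 w\eta=\eta\ \forall\eta\in F\}$ its stabilizer. *)

theory Defs
  imports "HOL-Analysis.Analysis" "HOL-Algebra.Generated_Groups"
begin

text \<open>
  The space \<open>\<hh>\<close> is a type \<open>'h::euclidean_space\<close>, whose inner product is not used. As every linear
  functional on a finite-dimensional space is bounded, \<open>'h \<Rightarrow>\<^sub>L real\<close> is the full dual \<open>\<hh>*\<close>, and
  the operator norm induces its canonical topology.

  The families \<open>\<alpha>\<close> and \<open>\<alpha>v\<close> of simple roots and coroots are indexed by a finite type \<open>'n\<close>.
  They are injective, so subsets of the set of simple roots are written as subsets of \<open>'n\<close>.
\<close>

definition gen_cartan_matrix :: "int ^ 'n ^ 'n \<Rightarrow> bool" where
  "gen_cartan_matrix A \<longleftrightarrow>
     (\<forall>i. A $ i $ i = 2) \<and>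
     (\<forall>i j. i \<noteq> j \<longrightarrow> A $ i $ j \<le> 0) \<and>
     (\<forall>i j. A $ i $ j = 0 \<longrightarrow> A $ j $ i = 0)"

definition realization ::
  "int ^ 'n ^ 'n \<Rightarrow> ('n \<Rightarrow> 'h::euclidean_space \<Rightarrow>\<^sub>L real) \<Rightarrow> ('n \<Rightarrow> 'h) \<Rightarrow> bool" where
  "realization A \<alpha> \<alpha>v \<longleftrightarrow>
     DIM('h) = 2 * CARD('n) - rank (\<chi> i j. real_of_int (A $ i $ j)) \<and>
     inj \<alpha> \<and> independent (range \<alpha>) \<and>
     inj \<alpha>v \<and> independent (range \<alpha>v) \<and>
     (\<forall>i j. blinfun_apply (\<alpha> j) (\<alpha>v i) = real_of_int (A $ i $ j))"

definition GL :: "('v::real_vector \<Rightarrow> 'v) monoid" where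
  "GL = \<lparr>carrier = {f. linear f \<and> bij f}, mult = (\<circ>), one = id\<rparr>"

definition simple_reflection ::
  "('n \<Rightarrow> 'h::euclidean_space \<Rightarrow>\<^sub>L real) \<Rightarrow> ('n \<Rightarrow> 'h) \<Rightarrow> 'n \<Rightarrow> ('h \<Rightarrow>\<^sub>L real) \<Rightarrow> ('h \<Rightarrow>\<^sub>L real)" where
  "simple_reflection \<alpha> \<alpha>v i \<eta> = \<eta> - blinfun_apply \<eta> (\<alpha>v i) *\<^sub>R \<alpha> i"

definition parabolic ::
  "('n \<Rightarrow> 'h::euclidean_space \<Rightarrow>\<^sub>L real) \<Rightarrow> ('n \<Rightarrow> 'h) \<Rightarrow> 'n set \<Rightarrow>
   (('h \<Rightarrow>\<^sub>L real) \<Rightarrow> ('h \<Rightarrow>\<^sub>L real)) set" where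
  "parabolic \<alpha> \<alpha>v I = generate GL (simple_reflection \<alpha> \<alpha>v ` I)"

definition weyl_group ::
  "('n \<Rightarrow> 'h::euclidean_space \<Rightarrow>\<^sub>L real) \<Rightarrow> ('n \<Rightarrow> 'h) \<Rightarrow>
   (('h \<Rightarrow>\<^sub>L real) \<Rightarrow> ('h \<Rightarrow>\<^sub>L real)) set" where
  "weyl_group \<alpha> \<alpha>v = parabolic \<alpha> \<alpha>v UNIV"

definition chamber :: "('n \<Rightarrow> 'h::euclidean_space) \<Rightarrow> ('h \<Rightarrow>\<^sub>L real) set" where
  "chamber \<alpha>v = {\<eta>. \<forall>i. blinfun_apply \<eta> (\<alpha>v i) \<ge> 0}"

text \<open>The convex hull of the orbit of \<open>\<mu>\<close> under the parabolic subgroup of \<open>I\<close>.\<close>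

definition orbit_hull ::
  "('n \<Rightarrow> 'h::euclidean_space \<Rightarrow>\<^sub>L real) \<Rightarrow> ('n \<Rightarrow> 'h) \<Rightarrow> ('h \<Rightarrow>\<^sub>L real) \<Rightarrow> 'n set \<Rightarrow>
   ('h \<Rightarrow>\<^sub>L real) set" where
  "orbit_hull \<alpha> \<alpha>v \<mu> I = convex hull ((\<lambda>w. w \<mu>) ` parabolic \<alpha> \<alpha>v I)"

definition weyl_hull ::
  "('n \<Rightarrow> 'h::euclidean_space \<Rightarrow>\<^sub>L real) \<Rightarrow> ('n \<Rightarrow> 'h) \<Rightarrow> ('h \<Rightarrow>\<^sub>L real) \<Rightarrow> ('h \<Rightarrow>\<^sub>L real) set" where
  "weyl_hull \<alpha> \<alpha>v \<mu> = convex hull ((\<lambda>w. w \<mu>) ` weyl_group \<alpha> \<alpha>v)"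

definition J0 :: "('n \<Rightarrow> 'h::euclidean_space) \<Rightarrow> ('h \<Rightarrow>\<^sub>L real) \<Rightarrow> 'n set" where
  "J0 \<alpha>v \<mu> = {i. blinfun_apply \<mu> (\<alpha>v i) = 0}"

definition adjacent ::
  "('n \<Rightarrow> 'h::euclidean_space \<Rightarrow>\<^sub>L real) \<Rightarrow> ('n \<Rightarrow> 'h) \<Rightarrow> 'n \<Rightarrow> 'n \<Rightarrow> bool" where
  "adjacent \<alpha> \<alpha>v i j \<longleftrightarrow> i \<noteq> j \<and> blinfun_apply (\<alpha> i) (\<alpha>v j) \<noteq> 0"

text \<open>
  Components of the subgraph induced on \<open>I\<close>. For a realization of a generalized Cartan matrix,
  \<^const>\<open>adjacent\<close> is symmetric, so directed reachability is connectedness.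
\<close>

definition dynkin_components ::
  "('n \<Rightarrow> 'h::euclidean_space \<Rightarrow>\<^sub>L real) \<Rightarrow> ('n \<Rightarrow> 'h) \<Rightarrow> 'n set \<Rightarrow> 'n set set" where
  "dynkin_components \<alpha> \<alpha>v I =
     {{j. (i, j) \<in> {(a, b). a \<in> I \<and> b \<in> I \<and> adjacent \<alpha> \<alpha>v a b}\<^sup>*} | i. i \<in> I}"

definition mu_connected ::
  "('n \<Rightarrow> 'h::euclidean_space \<Rightarrow>\<^sub>L real) \<Rightarrow> ('n \<Rightarrow> 'h) \<Rightarrow> ('h \<Rightarrow>\<^sub>L real) \<Rightarrow> 'n set \<Rightarrow> bool" where
  "mu_connected \<alpha> \<alpha>v \<mu> I \<longleftrightarrow> (\<forall>K \<in> dynkin_components \<alpha> \<alpha>v I. \<not> K \<subseteq> J0 \<alpha>v \<mu>)"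

definition lower_star ::
  "('n \<Rightarrow> 'h::euclidean_space \<Rightarrow>\<^sub>L real) \<Rightarrow> ('n \<Rightarrow> 'h) \<Rightarrow> ('h \<Rightarrow>\<^sub>L real) \<Rightarrow> 'n set \<Rightarrow> 'n set" where
  "lower_star \<alpha> \<alpha>v \<mu> I =
     {a \<in> J0 \<alpha>v \<mu> - I. \<forall>b \<in> I.
        simple_reflection \<alpha> \<alpha>v a \<circ> simple_reflection \<alpha> \<alpha>v b =
        simple_reflection \<alpha> \<alpha>v b \<circ> simple_reflection \<alpha> \<alpha>v a}"

definition fundamental_face ::
  "('n \<Rightarrow> 'h::euclidean_space \<Rightarrow>\<^sub>L real) \<Rightarrow> ('n \<Rightarrow> 'h) \<Rightarrow> ('h \<Rightarrow>\<^sub>L real) \<Rightarrow>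
   ('h \<Rightarrow>\<^sub>L real) set \<Rightarrow> bool" where
  "fundamental_face \<alpha> \<alpha>v \<mu> F \<longleftrightarrow>
     F face_of weyl_hull \<alpha> \<alpha>v \<mu> \<and> (F = {} \<or> rel_interior F \<inter> chamber \<alpha>v \<noteq> {})"

text \<open>
  Every nonempty fundamental face is \<^const>\<open>orbit_hull\<close> of a unique \<open>\<mu>\<close>-connected set, which the
  following definition picks out.
\<close>

definition lambda_up ::
  "('n \<Rightarrow> 'h::euclidean_space \<Rightarrow>\<^sub>L real) \<Rightarrow> ('n \<Rightarrow> 'h) \<Rightarrow> ('h \<Rightarrow>\<^sub>L real) \<Rightarrow>
   ('h \<Rightarrow>\<^sub>L real) set \<Rightarrow> 'n set" where
  "lambda_up \<alpha> \<alpha>v \<mu> F =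
     (if F = {} then {} else (THE I. mu_connected \<alpha> \<alpha>v \<mu> I \<and> F = orbit_hull \<alpha> \<alpha>v \<mu> I))"

definition lambda_low ::
  "('n \<Rightarrow> 'h::euclidean_space \<Rightarrow>\<^sub>L real) \<Rightarrow> ('n \<Rightarrow> 'h) \<Rightarrow> ('h \<Rightarrow>\<^sub>L real) \<Rightarrow>
   ('h \<Rightarrow>\<^sub>L real) set \<Rightarrow> 'n set" where
  "lambda_low \<alpha> \<alpha>v \<mu> F =
     (if F = {} then UNIV else lower_star \<alpha> \<alpha>v \<mu> (lambda_up \<alpha> \<alpha>v \<mu> F))"

definition lambda ::
  "('n \<Rightarrow> 'h::euclidean_space \<Rightarrow>\<^sub>L real) \<Rightarrow> ('n \<Rightarrow> 'h) \<Rightarrow> ('h \<Rightarrow>\<^sub>L real) \<Rightarrow>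
   ('h \<Rightarrow>\<^sub>L real) set \<Rightarrow> 'n set" where
  "lambda \<alpha> \<alpha>v \<mu> F = lambda_low \<alpha> \<alpha>v \<mu> F \<union> lambda_up \<alpha> \<alpha>v \<mu> F"

definition isotropy_group ::
  "('n \<Rightarrow> 'h::euclidean_space \<Rightarrow>\<^sub>L real) \<Rightarrow> ('n \<Rightarrow> 'h) \<Rightarrow> ('h \<Rightarrow>\<^sub>L real) set \<Rightarrow>
   (('h \<Rightarrow>\<^sub>L real) \<Rightarrow> ('h \<Rightarrow>\<^sub>L real)) set" where
  "isotropy_group \<alpha> \<alpha>v F = {w \<in> weyl_group \<alpha> \<alpha>v. w ` F = F}"

text \<open>The pointwise stabilizer.\<close>

definition face_stabilizer ::
  "('n \<Rightarrow> 'h::euclidean_space \<Rightarrow>\<^sub>L real) \<Rightarrow> ('n \<Rightarrow> 'h) \<Rightarrow> ('h \<Rightarrow>\<^sub>L real) set \<Rightarrow>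
   (('h \<Rightarrow>\<^sub>L real) \<Rightarrow> ('h \<Rightarrow>\<^sub>L real)) set" where
  "face_stabilizer \<alpha> \<alpha>v F = {w \<in> weyl_group \<alpha> \<alpha>v. \<forall>\<eta> \<in> F. w \<eta> = \<eta>}"

definition internal_direct_product ::
  "('a, 'b) monoid_scheme \<Rightarrow> 'a set \<Rightarrow> 'a set \<Rightarrow> 'a set \<Rightarrow> bool" where
  "internal_direct_product G K M N \<longleftrightarrow>
     M \<lhd> G\<lparr>carrier := K\<rparr> \<and> N \<lhd> G\<lparr>carrier := K\<rparr> \<and>
     M \<inter> N = {\<one>\<^bsub>G\<^esub>} \<and> M <#>\<^bsub>G\<^esub> N = K"

end

theory Submission
  imports Defs
begin

text \<open>
  The Weyl group is handled through words in the simple reflections. Tits' lemma (\<open>w\<close> maps the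
  chamber to the positive side of the wall \<open>i\<close> unless \<open>r\<^sub>i w\<close> is shorter than \<open>w\<close>) shows that
  \<open>\<mu> - w \<mu>\<close> is a nonnegative combination of simple roots and that the stabilizer of a dominant
  point is generated by the simple reflections fixing it.

  Let \<open>F\<close> be a face whose relative interior contains a dominant point, and let \<open>I\<close> be the union of
  the supports of \<open>\<mu> - w \<mu>\<close> over \<open>w \<mu> \<in> F\<close>. If \<open>F\<close> has points on both sides of a wall, then it is
  stable under the reflection in that wall. Hence \<open>\<mu> \<in> F\<close> and \<open>F = co (W\<^sub>I \<mu>)\<close>.

  Moving from \<open>\<mu>\<close> by small multiples of roots of \<open>I\<close>, in an order provided by connectedness, one finds
  a dominant point \<open>\<eta> \<in> F\<close> lying exactly on the walls of \<open>I\<^sub>*\<close>; so \<open>W\<^sub>*(F)\<close> lies in the stabilizer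
  \<open>W\<^bsub>I\<^sub>*\<^esub>\<close> of \<open>\<eta>\<close>. If \<open>w F = F\<close> and \<open>w\<close> is shortest in its coset \<open>W\<^sub>I w\<close>, then \<open>w \<eta>\<close> is dominant,
  so \<open>w \<in> W\<^bsub>I\<^sub>*\<^esub>\<close>.
\<close>

section \<open>Reflections, words and lengths\<close>

text \<open>
  The functionals \<open>\<omega> i\<close> express the independence of the simple roots: they read off the coefficients
  of elements of the root space.
\<close>

locale cartan_datum =
  fixes \<alpha> :: "'n::finite \<Rightarrow> 'v::real_normed_vector"
    and c :: "'n \<Rightarrow> 'v \<Rightarrow> real"
    and \<omega> :: "'n \<Rightarrow> 'v \<Rightarrow> real"
  assumes linear_c: "linear (c i)"
    and linear_\<omega>: "linear (\<omega> i)"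
    and c_self [simp]: "c i (\<alpha> i) = 2"
    and c_nonpos: "i \<noteq> j \<Longrightarrow> c i (\<alpha> j) \<le> 0"
    and c_sym: "c i (\<alpha> j) = 0 \<Longrightarrow> c j (\<alpha> i) = 0"
    and c_Ints: "c i (\<alpha> j) \<in> \<int>"
    and \<omega>_\<alpha>: "\<omega> i (\<alpha> j) = (if i = j then 1 else 0)"
begin

lemmas c_simps [simp] =
  linear_add[OF linear_c] linear_diff[OF linear_c] linear_scale[OF linear_c] linear_0[OF linear_c]

lemmas \<omega>_simps [simp] =
  linear_add[OF linear_\<omega>] linear_scale[OF linear_\<omega>] linear_0[OF linear_\<omega>] \<omega>_\<alpha>

definition r :: "'n \<Rightarrow> 'v \<Rightarrow> 'v" where
  "r i \<eta> = \<eta> - c i \<eta> *\<^sub>R \<alpha> i"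

abbreviation act :: "'n list \<Rightarrow> 'v \<Rightarrow> 'v" where
  "act xs \<equiv> foldr r xs"

text \<open>Words already form a group, since the reflections are involutions;
  \<open>generate_GL\<close> identifies it with the generated subgroup.\<close>

definition W :: "'n set \<Rightarrow> ('v \<Rightarrow> 'v) set" where
  "W I = {act xs | xs. set xs \<subseteq> I}"

text \<open>The length is relative to \<open>I\<close> because the half-space argument compares
  lengths in a dihedral subgroup with lengths in the larger group. The value is meaningful only on
  \<open>W I\<close>.\<close>

definition len :: "'n set \<Rightarrow> ('v \<Rightarrow> 'v) \<Rightarrow> nat" where
  "len I w = (LEAST n. \<exists>xs. set xs \<subseteq> I \<and> length xs = n \<and> act xs = w)"

definition dom :: "'n set \<Rightarrow> 'v set" where
  "dom I = {\<eta>. \<forall>i\<in>I. c i \<eta> \<ge> 0}"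

lemma linear_r: "linear (r i)"
  unfolding r_def by (rule linearI) (auto simp: algebra_simps)

lemma r_r [simp]: "r i (r i \<eta>) = \<eta>"
  by (simp add: r_def algebra_simps)

lemma r_o_r [simp]: "r i \<circ> (r i \<circ> w) = w"
  by auto

lemma c_r_self [simp]: "c i (r i \<eta>) = - c i \<eta>"
  by (simp add: r_def)

lemma act_append: "act (xs @ ys) = act xs \<circ> act ys"
  by auto

lemma act_rev: "act (rev xs) \<circ> act xs = id" "act xs \<circ> act (rev xs) = id"
proof -
  have *: "act (rev xs) \<circ> act xs = id" for xs
    by (induction xs) (auto simp: fun_eq_iff)
  show "act (rev xs) \<circ> act xs = id" "act xs \<circ> act (rev xs) = id"
    using *[of xs] *[of "rev xs"] by auto
qed

lemma W_id: "id \<in> W I"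
  unfolding W_def by (auto simp: id_def intro!: exI[of _ "[]"])

lemma W_comp: "u \<in> W I \<Longrightarrow> v \<in> W I \<Longrightarrow> u \<circ> v \<in> W I"
  unfolding W_def
proof clarsimp
  fix xs ys assume "set xs \<subseteq> I" "set ys \<subseteq> I"
  then show "\<exists>zs. act xs \<circ> act ys = act zs \<and> set zs \<subseteq> I"
    by (intro exI[of _ "xs @ ys"]) auto
qed

lemma W_r: "i \<in> I \<Longrightarrow> r i \<in> W I"
  unfolding W_def by (auto intro!: exI[of _ "[i]"])

lemma W_mono: "I \<subseteq> J \<Longrightarrow> W I \<subseteq> W J"
  unfolding W_def by blast

lemma W_inv: 
  assumes "w \<in> W I" obtains v where "v \<in> W I" "v \<circ> w = id" "w \<circ> v = id"
proof -
  obtain xs where "set xs \<subseteq> I" "w = act xs" using assms by (auto simp: W_def)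
  then have "act (rev xs) \<in> W I" "act (rev xs) \<circ> w = id" "w \<circ> act (rev xs) = id"
    by (auto simp: W_def act_rev intro!: exI[of _ "rev xs"])
  then show ?thesis using that by blast
qed

lemma W_empty [simp]: "W {} = {id}"
  by (auto simp: W_def id_def)

lemma len_le: "set xs \<subseteq> I \<Longrightarrow> len I (act xs) \<le> length xs"
  unfolding len_def by (rule Least_le) blast

lemma reduced_word:
  assumes "w \<in> W I" obtains xs where "set xs \<subseteq> I" "act xs = w" "length xs = len I w"
proof -
  have "\<exists>n xs. set xs \<subseteq> I \<and> length xs = n \<and> act xs = w"
    using assms by (auto simp: W_def)
  then have "\<exists>xs. set xs \<subseteq> I \<and> length xs = len I w \<and> act xs = w"
    unfolding len_def by (rule LeastI_ex)
  then show ?thesis using that by blast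
qed

lemma len_comp:
  assumes "u \<in> W I" "v \<in> W I" shows "len I (u \<circ> v) \<le> len I u + len I v"
proof -
  obtain xs where x: "set xs \<subseteq> I" "act xs = u" "length xs = len I u" using reduced_word assms by metis
  obtain ys where y: "set ys \<subseteq> I" "act ys = v" "length ys = len I v" using reduced_word assms by metis
  have "len I (act (xs @ ys)) \<le> length (xs @ ys)" by (rule len_le) (use x y in auto)
  then show ?thesis using x y by (simp add: act_append del: foldr_append)
qed

lemma len_r: "i \<in> I \<Longrightarrow> len I (r i) \<le> 1"
  using len_le[of "[i]" I] by simp

lemma len_mono:
  assumes "w \<in> W I" "I \<subseteq> J" shows "len J w \<le> len I w"
proof -
  obtain xs where "set xs \<subseteq> I" "act xs = w" "length xs = len I w" using reduced_word assms by metis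
  then show ?thesis using len_le[of xs J] assms by auto
qed

lemma descent:
  assumes "w \<in> W I" "w \<noteq> id" 
  obtains i v where "i \<in> I" "v \<in> W I" "w = r i \<circ> v" "r i \<circ> w = v" "len I w = Suc (len I v)"
proof -
  obtain xs where x: "set xs \<subseteq> I" "act xs = w" "length xs = len I w" using reduced_word assms by metis
  with assms obtain i ys where xs: "xs = i # ys" by (cases xs) (auto simp: id_def)
  have v: "act ys \<in> W I" using x xs by (auto simp: W_def)
  have w: "w = r i \<circ> act ys" using x xs by simp
  have 1: "len I (act ys) \<le> length ys" using len_le x xs by simp
  have 2: "len I w \<le> Suc (len I (act ys))"
    using len_comp[OF W_r v, of i] len_r[of i I] x xs w by simp
  show ?thesis using that[of i "act ys"] 1 2 x xs v w by auto
qed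

section \<open>Alternating words and dihedral relations\<close>

fun alt :: "'n \<Rightarrow> 'n \<Rightarrow> nat \<Rightarrow> 'n list" where
  "alt x y 0 = []"
| "alt x y (Suc n) = x # alt y x n"

lemma length_alt [simp]: "length (alt x y n) = n"
  by (induction x y n rule: alt.induct) auto

lemma set_alt: "set (alt x y n) \<subseteq> {x, y}"
  by (induction x y n rule: alt.induct) auto

lemma alt_add: "alt x y (m + n) = alt x y m @ (if even m then alt x y n else alt y x n)"
  by (induction x y m rule: alt.induct) auto

lemma alternating:
  assumes "set xs \<subseteq> {x, y}" "distinct_adj xs" "xs = [] \<or> hd xs = x"
  shows "xs = alt x y (length xs)"
  using assms
proof (induction xs arbitrary: x y)
  case (Cons a xs)
  then have "a = x" by simp
  moreover have "xs = [] \<or> hd xs = y" using Cons.prems by (cases xs) auto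
  then have "xs = alt y x (length xs)" using Cons by (intro Cons.IH) (auto simp: distinct_adj_Cons)
  ultimately show ?case by simp
qed simp

text \<open>The second inequality only serves to make the induction go through.\<close>

lemma act_alt_infinite:
  assumes "s \<noteq> t" "c s (\<alpha> t) * c t (\<alpha> s) \<ge> 4" "c s \<eta> \<ge> 0" "c t \<eta> \<ge> 0"
  shows "c s (act (alt t s n) \<eta>) \<ge> 0 \<and> 2 * c t (act (alt t s n) \<eta>) - c t (\<alpha> s) * c s (act (alt t s n) \<eta>) \<ge> 0"
  using assms
proof (induction n arbitrary: s t)
  case 0
  then show ?case using c_nonpos[of t s] mult_nonpos_nonneg[of "c t (\<alpha> s)" "c s \<eta>"] by simp
next
  case (Suc n)
  let ?\<xi> = "act (alt s t n) \<eta>" 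
  define x y a b where "x = c s ?\<xi>" and "y = c t ?\<xi>" and "a = - c s (\<alpha> t)" and "b = - c t (\<alpha> s)"
  \<comment> \<open>Removing the leading \<open>t\<close> exchanges the two letters, so the
    induction hypothesis is applied with \<open>s\<close> and \<open>t\<close> swapped.\<close>
  have IH: "y \<ge> 0" "2 * x + a * y \<ge> 0"
    using Suc.IH[of t s] Suc.prems by (auto simp: mult.commute x_def y_def a_def)
  have ab: "a \<ge> 0" "b \<ge> 0" "a * b \<ge> 4" using Suc.prems c_nonpos by (auto simp: a_def b_def)
  have 1: "c s (act (alt t s (Suc n)) \<eta>) = x + a * y" "c t (act (alt t s (Suc n)) \<eta>) = - y"
    by (auto simp: r_def x_def y_def a_def algebra_simps)
  have "0 \<le> a * y" using ab IH by simp
  then have "x + a * y \<ge> 0" using IH by linarith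
  \<comment> \<open>The new second quantity is \<open>b * x + (a * b - 2) * y\<close>, half the sum
    of this product and the next one.\<close>
  moreover have "b * (2 * x + a * y) \<ge> 0" using ab IH by simp
  moreover have "(a * b - 4) * y \<ge> 0" using ab IH by simp
  ultimately show ?case unfolding 1 b_def[symmetric]
    using b_def by (simp add: algebra_simps)
qed

text \<open>Both entries are nonpositive integers that vanish together, so a product below 4 leaves
  only the pairs of the finite rank-two types.\<close>

lemma cartan_products:
  assumes "s \<noteq> t" "c s (\<alpha> t) * c t (\<alpha> s) < 4"
  shows "(c s (\<alpha> t), c t (\<alpha> s)) \<in> {(0,0), (-1,-1), (-1,-2), (-2,-1), (-1,-3), (-3,-1)}"
proof -
  obtain a b where ab: "c s (\<alpha> t) = of_int (- a)" "c t (\<alpha> s) = of_int (- b)"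
    using c_Ints[of s t] c_Ints[of t s] by (metis Ints_cases minus_minus)
  have nn: "a \<ge> 0" "b \<ge> 0" using ab c_nonpos[of s t] c_nonpos[of t s] assms by auto
  have "of_int (a * b) < (of_int 4::real)" using assms ab by simp
  then have lt: "a * b < 4" unfolding of_int_less_iff .
  have z: "a = 0 \<longleftrightarrow> b = 0" using c_sym[of s t] c_sym[of t s] ab by auto
  show ?thesis
  proof (cases "a = 0")
    case True then show ?thesis using z ab by simp
  next
    case False
    then have ge: "a \<ge> 1" "b \<ge> 1" using nn z by auto
    have "a * 1 \<le> a * b" using ge by (intro mult_left_mono) auto
    moreover have "1 * b \<le> a * b" using ge by (intro mult_right_mono) auto
    ultimately have "a < 4" "b < 4" using lt by auto
    then have "a \<in> {1,2,3}" "b \<in> {1,2,3}" using ge by auto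
    then show ?thesis using lt ab by auto
  qed
qed

text \<open>The types A1 x A1, A2, B2 and G2 have \<open>m\<close> equal to 2, 3, 4 and 6, the order
  of \<open>r s \<circ> r t\<close>. Each is settled by computing alternating words of length at
  most \<open>m\<close>.\<close>

lemma braid:
  assumes "s \<noteq> t" "c s (\<alpha> t) * c t (\<alpha> s) < 4"
  obtains m where "m > 0" "\<And>\<eta>. act (alt s t m) \<eta> = act (alt t s m) \<eta>"
    "\<And>n \<eta>. n < m \<Longrightarrow> c s \<eta> \<ge> 0 \<Longrightarrow> c t \<eta> \<ge> 0 \<Longrightarrow> c s (act (alt t s n) \<eta>) \<ge> 0"
proof -
  \<comment> \<open>\<open>N\<close> subtracts from \<eta> a combination of the two roots whose
    coefficients are linear in \<open>c s \<eta>\<close> and \<open>c t \<eta>\<close>. A reflection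
    changes only these coefficients, so words can be evaluated by arithmetic.\<close>
  define N where "N \<eta> p p' q q' =
    \<eta> - (p * c s \<eta> + p' * c t \<eta>) *\<^sub>R \<alpha> s - (q * c s \<eta> + q' * c t \<eta>) *\<^sub>R \<alpha> t" for \<eta> p p' q q'
  have c_N: "c s (N \<eta> p p' q q') = (1 - 2 * p - q * c s (\<alpha> t)) * c s \<eta> + (- 2 * p' - q' * c s (\<alpha> t)) * c t \<eta>"
    "c t (N \<eta> p p' q q') = (- 2 * q - p * c t (\<alpha> s)) * c s \<eta> + (1 - 2 * q' - p' * c t (\<alpha> s)) * c t \<eta>"
    for \<eta> p p' q q'
    by (auto simp: N_def algebra_simps)
  have N_add: "N \<eta> p p' q q' - (k * c s \<eta> + k' * c t \<eta>) *\<^sub>R \<alpha> s = N \<eta> (p + k) (p' + k') q q'"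
    "N \<eta> p p' q q' - (k * c s \<eta> + k' * c t \<eta>) *\<^sub>R \<alpha> t = N \<eta> p p' (q + k) (q' + k')" for \<eta> p p' q q' k k'
    by (auto simp: N_def algebra_simps)
  have r_N: "r s (N \<eta> p p' q q') = N \<eta> (1 - p - q * c s (\<alpha> t)) (- p' - q' * c s (\<alpha> t)) q q'"
    "r t (N \<eta> p p' q q') = N \<eta> p p' (- q - p * c t (\<alpha> s)) (1 - q' - p' * c t (\<alpha> s))" for \<eta> p p' q q'
    unfolding r_def c_N N_add by (auto simp: algebra_simps)
  have N_0: "N \<eta> 0 0 0 0 = \<eta>" for \<eta>
    by (simp add: N_def)
  have alts: "alt x y 2 = [x,y]" "alt x y 3 = [x,y,x]" "alt x y 4 = [x,y,x,y]"
    "alt x y 5 = [x,y,x,y,x]" "alt x y 6 = [x,y,x,y,x,y]" for x y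
    by (simp_all add: numeral_eq_Suc)
  have small: "n < 2 \<Longrightarrow> n = 0 \<or> n = 1" "n < 3 \<Longrightarrow> n = 0 \<or> n = 1 \<or> n = 2"
    "n < 4 \<Longrightarrow> n = 0 \<or> n = 1 \<or> n = 2 \<or> n = 3"
    "n < 6 \<Longrightarrow> n = 0 \<or> n = 1 \<or> n = 2 \<or> n = 3 \<or> n = 4 \<or> n = 5" for n :: nat
    by auto
  consider "c s (\<alpha> t) = 0" "c t (\<alpha> s) = 0" | "c s (\<alpha> t) = -1" "c t (\<alpha> s) = -1"
    | "c s (\<alpha> t) = -1" "c t (\<alpha> s) = -2" | "c s (\<alpha> t) = -2" "c t (\<alpha> s) = -1"
    | "c s (\<alpha> t) = -1" "c t (\<alpha> s) = -3" | "c s (\<alpha> t) = -3" "c t (\<alpha> s) = -1"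
    using cartan_products[OF assms] by auto
  \<comment> \<open>Writing \<eta> as \<open>N \<eta> 0 0 0 0\<close> lets the rules
    \<open>r_N\<close> and \<open>c_N\<close> evaluate every word.\<close>
  then have "\<exists>m>0. (\<forall>\<eta>. act (alt s t m) (N \<eta> 0 0 0 0) = act (alt t s m) (N \<eta> 0 0 0 0)) \<and>
    (\<forall>n \<eta>. n < m \<longrightarrow> c s \<eta> \<ge> 0 \<longrightarrow> c t \<eta> \<ge> 0 \<longrightarrow> c s (act (alt t s n) (N \<eta> 0 0 0 0)) \<ge> 0)"
  proof cases
    case 1
    show ?thesis by (rule exI[of _ 2]) (auto simp: alts r_N c_N 1 dest!: small)
  next
    case 2
    show ?thesis by (rule exI[of _ 3]) (auto simp: alts r_N c_N 2 dest!: small)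
  next
    case 3
    show ?thesis by (rule exI[of _ 4]) (auto simp: alts r_N c_N 3 dest!: small)
  next
    case 4
    show ?thesis by (rule exI[of _ 4]) (auto simp: alts r_N c_N 4 dest!: small)
  next
    case 5
    show ?thesis by (rule exI[of _ 6]) (auto simp: alts r_N c_N 5 dest!: small)
  next
    case 6
    show ?thesis by (rule exI[of _ 6]) (auto simp: alts r_N c_N 6 dest!: small)
  qed
  then show ?thesis
    using that unfolding N_0 by blast
qed

section \<open>The half-space lemma\<close>

text \<open>Two equal neighbouring letters would cancel and leave a shorter word; tails of reduced
  words are reduced again.\<close>

lemma reduced_distinct_adj:
  assumes "set xs \<subseteq> I" "len I (act xs) = length xs"
  shows "distinct_adj xs"
  using assms
proof (induction xs)
  case (Cons a xs)
  have xs: "act xs \<in> W I" using Cons.prems by (auto simp: W_def)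
  have "len I (act (a # xs)) \<le> 1 + len I (act xs)"
    using len_comp[OF W_r xs, of a] len_r[of a I] Cons.prems by (simp add: o_def)
  moreover have "len I (act xs) \<le> length xs" using Cons.prems by (intro len_le) auto
  ultimately have "distinct_adj xs" using Cons by (simp add: o_def)
  moreover have "a \<noteq> hd xs" if ne: "xs \<noteq> []"
  proof
    assume "a = hd xs"
    then obtain ys where ys: "xs = a # ys" using ne by (cases xs) auto
    then have eq: "act (a # xs) = act ys" by auto
    have "len I (act ys) \<le> length ys" using Cons.prems ys by (intro len_le) auto
    then show False using Cons.prems(2) ys unfolding eq by simp
  qed
  ultimately show ?case by (auto simp: distinct_adj_Cons)
qed simp

text \<open>A reduced word in two letters alternates, and it cannot begin with \<open>s\<close>,
  since \<open>r s\<close> would shorten it. So it is the word treated by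
  \<open>act_alt_infinite\<close> and \<open>braid\<close>.\<close>

lemma half_space_rank_two:
  assumes "s \<noteq> t" "set xs \<subseteq> {s, t}" "len {s, t} (act xs) = length xs"
    and \<eta>: "c s \<eta> \<ge> 0" "c t \<eta> \<ge> 0"
    and len: "length xs \<le> len {s, t} (r s \<circ> act xs)"
  shows "c s (act xs \<eta>) \<ge> 0"
proof -
  have hd: "xs = [] \<or> hd xs = t"
  proof (rule ccontr)
    assume "\<not> (xs = [] \<or> hd xs = t)"
    then obtain ys where ys: "xs = s # ys" using assms(2) by (cases xs) auto
    then have "r s \<circ> act xs = act ys" by auto
    then have "len {s, t} (r s \<circ> act xs) \<le> length ys" using assms(2) ys by (simp only:, intro len_le) auto
    then show False using len ys by simp
  qed
  have "distinct_adj xs" by (rule reduced_distinct_adj[OF assms(2,3)])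
  then have xs: "xs = alt t s (length xs)"
    using alternating[of xs t s] hd assms(2) by auto
  show ?thesis
  proof (cases "c s (\<alpha> t) * c t (\<alpha> s) \<ge> 4")
    case True
    then show ?thesis using act_alt_infinite[OF assms(1) True \<eta>, of "length xs"] xs by metis
  next
    case False
    then obtain m where m: "m > 0" "\<And>\<eta>. act (alt s t m) \<eta> = act (alt t s m) \<eta>"
      "\<And>n \<eta>. n < m \<Longrightarrow> c s \<eta> \<ge> 0 \<Longrightarrow> c t \<eta> \<ge> 0 \<Longrightarrow> c s (act (alt t s n) \<eta>) \<ge> 0"
      using braid[OF assms(1)] by (metis not_le)
    \<comment> \<open>From length \<open>m\<close> on, the braid relation would rewrite the word so
      that it begins with \<open>s\<close>, and \<open>r s\<close> would shorten it.\<close>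
    have "length xs < m"
    proof (rule ccontr)
      assume "\<not> length xs < m"
      then obtain k where k: "length xs = m + k" using le_Suc_ex not_less by metis
      obtain ys where ys: "xs = alt t s m @ ys" "set ys \<subseteq> {s, t}" "length ys = k"
      proof
        show "xs = alt t s m @ (if even m then alt t s k else alt s t k)"
          using xs alt_add[of t s m k] unfolding k by (rule trans)
      qed (use set_alt[of s t k] set_alt[of t s k] in auto)
      obtain m' where m': "m = Suc m'" using m by (cases m) auto
      have "r s \<circ> act xs = act (alt t s m' @ ys)"
      proof
        fix \<xi> 
        have "act xs \<xi> = act (alt s t m) (act ys \<xi>)" using m(2) ys by simp
        then show "(r s \<circ> act xs) \<xi> = act (alt t s m' @ ys) \<xi>" by (simp add: m')
      qed
      then have "len {s, t} (r s \<circ> act xs) \<le> length (alt t s m' @ ys)"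
        using set_alt[of t s m'] ys by (simp only:, intro len_le) auto
      then show False using len ys k m' by simp
    qed
    then show ?thesis using m(3)[OF _ \<eta>] xs by metis
  qed
qed

text \<open>
  This is Tits' half-space lemma. A minimal \<open>v\<close> with \<open>w = u \<circ> v\<close>, \<open>u\<close> in the dihedral group of
  \<open>i\<close> and a left descent \<open>t\<close> of \<open>w\<close>, reduces it to rank two.
\<close>

lemma half_space:
  assumes "w \<in> W I" "i \<in> I" "\<eta> \<in> dom I" "len I w \<le> len I (r i \<circ> w)"
  shows "c i (w \<eta>) \<ge> 0"
  using assms(1,2,4)
proof (induction "len I w" arbitrary: w i rule: less_induct)
  case less
  show ?case
  proof (cases "w = id")
    case True
    then show ?thesis using less assms(3) by (auto simp: dom_def)
  next
    case False
    obtain t v0 where t: "t \<in> I" "v0 \<in> W I" "w = r t \<circ> v0" "r t \<circ> w = v0" "len I w = Suc (len I v0)"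
      using descent[OF less.prems(1) False] by metis
    have "t \<noteq> i" using less.prems t by auto
    let ?P = "{i, t}"
    have PI: "?P \<subseteq> I" using t less by auto
    define A where "A v \<longleftrightarrow> v \<in> W I \<and> (\<exists>u\<in>W ?P. w = u \<circ> v \<and> len ?P u + len I v \<le> len I w)" for v
    have "A v0" unfolding A_def
      using t len_r[of t ?P] W_r[of t ?P] by auto
    then obtain v where v: "A v" "\<And>v'. A v' \<Longrightarrow> len I v \<le> len I v'"
      using ex_has_least_nat[of A v0 "len I"] by blast
    obtain u where u: "v \<in> W I" "u \<in> W ?P" "w = u \<circ> v" "len ?P u + len I v \<le> len I w"
      using v A_def by blast
    have less_v: "len I v < len I w" using v(2)[OF \<open>A v0\<close>] t by simp
    \<comment> \<open>If \<open>r x\<close> shortened \<open>v\<close>, it could be moved from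
      \<open>v\<close> into \<open>u\<close>, against the minimality of \<open>v\<close>. As
      \<open>v\<close> is shorter than \<open>w\<close>, the induction hypothesis applies.\<close>
    have dom_v: "c x (v \<eta>) \<ge> 0" if x: "x \<in> ?P" for x
    proof (rule less.hyps[OF less_v u(1)])
      show xI: "x \<in> I" using x PI by auto
      show "len I v \<le> len I (r x \<circ> v)"
      proof (rule ccontr)
        assume lt: "\<not> len I v \<le> len I (r x \<circ> v)"
        have "len ?P (u \<circ> r x) \<le> len ?P u + 1"
          using len_comp[OF u(2) W_r[OF x]] len_r[OF x] by simp
        moreover have "u \<circ> r x \<in> W ?P" "r x \<circ> v \<in> W I" "w = (u \<circ> r x) \<circ> (r x \<circ> v)"
          using W_comp W_r u x xI by (auto simp: fun_eq_iff)
        moreover have "len ?P u + 1 + len I (r x \<circ> v) \<le> len I w" using lt u(4) by simp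
        ultimately have "A (r x \<circ> v)" unfolding A_def
          by (intro conjI bexI[of _ "u \<circ> r x"]) linarith+
        then show False using v(2) lt by auto
      qed
    qed
    obtain xs where xs: "set xs \<subseteq> ?P" "act xs = u" "length xs = len ?P u"
      using reduced_word[OF u(2)] by metis
    have ru: "r i \<circ> u \<in> W ?P" using W_comp W_r u by blast
    \<comment> \<open>Since \<open>len u + len v\<close> is at most \<open>len w\<close>, hence at
      most the length of \<open>r i \<circ> w\<close>, this estimate shows that \<open>r i\<close>
      does not shorten \<open>u\<close> within the dihedral group.\<close>
    have "len I (r i \<circ> w) \<le> len I (r i \<circ> u) + len I v"
      using len_comp[of "r i \<circ> u" I v] ru W_mono[OF PI] u by (auto simp: o_assoc)
    also have "len I (r i \<circ> u) \<le> len ?P (r i \<circ> u)" by (rule len_mono[OF ru PI])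
    finally have "length xs \<le> len ?P (r i \<circ> act xs)" using less.prems u(4) xs by simp
    then have "c i (act xs (v \<eta>)) \<ge> 0"
      using half_space_rank_two[of i t xs "v \<eta>"] \<open>t \<noteq> i\<close> xs dom_v by auto
    then show ?thesis using xs u by simp
  qed
qed

section \<open>Stabilizers and orbits of dominant points\<close>

text \<open>Split off a left descent, \<open>w = r i \<circ> v\<close>. The half-space lemma gives
  \<open>c i (v \<eta>) \<ge> 0\<close>, dominance of \<open>w \<eta>\<close> gives the reverse, so
  \<open>r i\<close> fixes \<open>v \<eta>\<close> and induction applies to
  \<open>v\<close>.\<close>

lemma dominant_stabilizer:
  assumes "w \<in> W I" "\<eta> \<in> dom I" "w \<eta> \<in> dom I"
  shows "w \<eta> = \<eta> \<and> w \<in> W {i \<in> I. c i \<eta> = 0}"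
  using assms(1,3)
proof (induction "len I w" arbitrary: w rule: less_induct)
  case less
  show ?case
  proof (cases "w = id")
    case True
    then show ?thesis using W_id by simp
  next
    case False
    obtain i v where v: "i \<in> I" "v \<in> W I" "w = r i \<circ> v" "r i \<circ> w = v" "len I w = Suc (len I v)"
      using descent[OF less.prems(1) False] by metis
    then have "c i (v \<eta>) \<ge> 0" using half_space[OF v(2,1) assms(2)] by simp
    moreover have "c i (w \<eta>) = - c i (v \<eta>)" using v by simp
    moreover have "c i (w \<eta>) \<ge> 0" using less.prems v by (auto simp: dom_def)
    ultimately have z: "c i (v \<eta>) = 0" by simp
    then have weq: "w \<eta> = v \<eta>" using v by (simp add: r_def)
    have IH: "v \<eta> = \<eta> \<and> v \<in> W {i \<in> I. c i \<eta> = 0}"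
      by (rule less.hyps) (use v weq less.prems in auto)
    then have "r i \<in> W {i \<in> I. c i \<eta> = 0}" using z v by (intro W_r) auto
    then show ?thesis using IH W_comp v weq by auto
  qed
qed

definition orbit :: "'n set \<Rightarrow> 'v \<Rightarrow> 'v set" where
  "orbit I \<mu> = (\<lambda>w. w \<mu>) ` W I"

lemma orbit_self: "\<mu> \<in> orbit I \<mu>"
  unfolding orbit_def using W_id by (auto intro!: image_eqI[of _ _ id])

lemma orbit_r: "\<xi> \<in> orbit I \<mu> \<Longrightarrow> i \<in> I \<Longrightarrow> r i \<xi> \<in> orbit I \<mu>"
  unfolding orbit_def using W_comp[OF W_r, of i I] by (auto intro!: image_eqI[of _ _ "r i \<circ> _"])

lemma orbit_descend [consumes 2, case_names base step]:
  assumes "\<xi> \<in> orbit I \<mu>" "\<mu> \<in> dom I" "P \<mu>"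
    and step: "\<And>\<xi> i. \<xi> \<in> orbit I \<mu> \<Longrightarrow> i \<in> I \<Longrightarrow> c i \<xi> > 0 \<Longrightarrow> P \<xi> \<Longrightarrow> P (r i \<xi>)"
  shows "P \<xi>"
proof -
  have "P (w \<mu>)" if "w \<in> W I" for w
    using that
  proof (induction "len I w" arbitrary: w rule: less_induct)
    case less
    show ?case
    proof (cases "w = id")
      case True
      then show ?thesis using assms by simp
    next
      case False
      obtain i v where v: "i \<in> I" "v \<in> W I" "w = r i \<circ> v" "r i \<circ> w = v" "len I w = Suc (len I v)"
        using descent[OF less.prems(1) False] by metis
      have Pv: "P (v \<mu>)" using less.hyps v by simp
      have "c i (v \<mu>) \<ge> 0" using half_space[OF v(2,1) assms(2)] v by simp
      then consider "c i (v \<mu>) = 0" | "c i (v \<mu>) > 0" by linarith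
      then show ?thesis
      proof cases
        case 1 then show ?thesis using v Pv by (simp add: r_def)
      next
        case 2 then show ?thesis using step[OF _ v(1) 2 Pv] v by (simp add: orbit_def)
      qed
    qed
  qed
  then show ?thesis using assms by (auto simp: orbit_def)
qed

lemma \<omega>_r: "\<omega> i (\<mu> - r j \<xi>) = \<omega> i (\<mu> - \<xi>) + (if i = j then c j \<xi> else 0)"
  by (simp add: r_def linear_diff[OF linear_\<omega>])

lemma orbit_\<omega>_nonneg:
  assumes "\<xi> \<in> orbit UNIV \<mu>" "\<mu> \<in> dom UNIV"
  shows "\<omega> i (\<mu> - \<xi>) \<ge> 0"
  using assms by (induction rule: orbit_descend) (simp, simp add: \<omega>_r)

end

section \<open>Fundamental faces\<close>

text \<open>A proper convex combination lying in \<open>F\<close> has both end points in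
  \<open>F\<close>. Hence \<open>?G\<close> is convex, and it contains \<open>S\<close>.\<close>

lemma face_of_convex_hull_subset_hull:
  assumes "F face_of convex hull S"
  shows "F \<subseteq> convex hull (F \<inter> S)"
proof -
  let ?G = "{x \<in> convex hull S. x \<in> F \<longrightarrow> x \<in> convex hull (F \<inter> S)}"
  have "x \<in> ?G" if "x \<in> convex hull S" for x
  proof -
    have "convex hull S \<subseteq> ?G"
    proof (rule hull_minimal)
      show "S \<subseteq> ?G" using hull_subset[of S convex] hull_subset[of "F \<inter> S" convex] by auto
      show "convex ?G"
      proof (rule convexI)
        fix x y u v assume xy: "x \<in> ?G" "y \<in> ?G" and uv: "(0::real) \<le> u" "0 \<le> v" "u + v = 1"
        let ?z = "u *\<^sub>R x + v *\<^sub>R y"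
        have zS: "?z \<in> convex hull S" using xy uv by (intro convexD[OF convex_convex_hull]) auto
        moreover have "?z \<in> convex hull (F \<inter> S)" if z: "?z \<in> F"
        proof (cases "x = y \<or> u = 0 \<or> v = 0")
          case True
          then have "?z = x \<or> ?z = y" using uv scaleR_add_left[of u v x] by auto
          then show ?thesis using xy z by auto
        next
          case False
          then have "?z \<in> open_segment x y" using uv
            by (auto simp: in_segment intro!: exI[of _ v])
          then have "x \<in> F" "y \<in> F" using face_ofD[OF assms] xy z by blast+
          then show ?thesis using xy uv by (intro convexD[OF convex_convex_hull]) auto
        qed
        ultimately show "?z \<in> ?G" by simp
      qed
    qed
    then show ?thesis using that by blast
  qed
  then show ?thesis using face_of_imp_subset[OF assms] by blast
qed

text \<open>The prolonged point stays in the affine hull of \<open>F\<close>, and \<open>e\<close>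
  is small enough to keep it in a ball around \<eta>. The summand 1 in the denominator covers the
  case \<open>v = \<eta>\<close>.\<close>

lemma rel_interior_prolong:
  fixes \<eta> v :: "'a::real_normed_vector"
  assumes "\<eta> \<in> rel_interior F" "v \<in> F"
  obtains e where "e > 0" "\<eta> + e *\<^sub>R (\<eta> - v) \<in> F"
proof -
  obtain d where d: "\<eta> \<in> F" "d > 0" "ball \<eta> d \<inter> affine hull F \<subseteq> F"
    using assms(1) by (auto simp: mem_rel_interior_ball)
  define e where "e = d / (norm (\<eta> - v) + 1)"
  have n: "norm (\<eta> - v) + 1 > 0" by (simp add: add_nonneg_pos)
  have e: "e > 0" using d n by (simp add: e_def)
  have "e * norm (\<eta> - v) < e * (norm (\<eta> - v) + 1)" using e by simp
  also have "\<dots> = d" using n by (simp add: e_def)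
  finally have "\<eta> + e *\<^sub>R (\<eta> - v) \<in> ball \<eta> d" using e by (simp add: dist_norm)
  moreover have "(1 + e) *\<^sub>R \<eta> + (- e) *\<^sub>R v \<in> affine hull F"
    using d assms hull_subset[of F affine] by (intro mem_affine) auto
  ultimately have "\<eta> + e *\<^sub>R (\<eta> - v) \<in> F" using d by (auto simp: algebra_simps)
  then show ?thesis using that e by blast
qed

section \<open>Root cones and hulls of orbits\<close>

context cartan_datum
begin

text \<open>These are the nonnegative combinations of the roots of \<open>I\<close>. The last
  conjunct places \<open>a\<close> in the root space; elsewhere the values of
  \<open>\<omega>\<close> do not determine it.\<close>

definition root_cone :: "'n set \<Rightarrow> 'v set" where
  "root_cone I = {a. (\<forall>i. \<omega> i a \<ge> 0) \<and> (\<forall>i. i \<notin> I \<longrightarrow> \<omega> i a = 0) \<and> a = (\<Sum>i\<in>UNIV. \<omega> i a *\<^sub>R \<alpha> i)}"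

lemma root_coneD: "a \<in> root_cone I \<Longrightarrow> \<omega> i a \<ge> 0" "a \<in> root_cone I \<Longrightarrow> i \<notin> I \<Longrightarrow> \<omega> i a = 0"
  by (simp_all add: root_cone_def)

lemma root_cone_0: "0 \<in> root_cone I"
  by (simp add: root_cone_def)

lemma root_cone_scale: "a \<in> root_cone I \<Longrightarrow> t \<ge> 0 \<Longrightarrow> t *\<^sub>R a \<in> root_cone I"
  by (auto simp: root_cone_def scaleR_sum_right[symmetric] simp flip: scaleR_scaleR)

lemma root_cone_add: "a \<in> root_cone I \<Longrightarrow> b \<in> root_cone I \<Longrightarrow> a + b \<in> root_cone I"
  by (auto simp: root_cone_def scaleR_add_left sum.distrib)

lemma root_cone_\<alpha>: "i \<in> I \<Longrightarrow> \<alpha> i \<in> root_cone I"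
  by (auto simp: root_cone_def if_distrib[of "\<lambda>x. x *\<^sub>R _"] cong: if_cong)

lemma convex_minus_root_cone: "convex {\<xi>. \<mu> - \<xi> \<in> root_cone I}"
proof (rule convexI)
  fix x y and u v :: real
  assume *: "x \<in> {\<xi>. \<mu> - \<xi> \<in> root_cone I}" "y \<in> {\<xi>. \<mu> - \<xi> \<in> root_cone I}" "0 \<le> u" "0 \<le> v" "u + v = 1"
  have "\<mu> - (u *\<^sub>R x + v *\<^sub>R y) = u *\<^sub>R (\<mu> - x) + v *\<^sub>R (\<mu> - y)"
    using scaleR_add_left[of u v \<mu>] * by (simp add: algebra_simps)
  then show "u *\<^sub>R x + v *\<^sub>R y \<in> {\<xi>. \<mu> - \<xi> \<in> root_cone I}"
    using * root_cone_scale root_cone_add by simp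
qed

lemma c_root_cone:
  assumes "\<mu> - \<xi> \<in> root_cone I"
  shows "c j \<xi> = c j \<mu> - (\<Sum>i\<in>I. \<omega> i (\<mu> - \<xi>) * c j (\<alpha> i))"
proof -
  have "\<xi> = \<mu> - (\<mu> - \<xi>)" by simp
  also have "c j \<dots> = c j \<mu> - c j (\<mu> - \<xi>)" by (rule linear_diff[OF linear_c])
  also have "\<mu> - \<xi> = (\<Sum>i\<in>UNIV. \<omega> i (\<mu> - \<xi>) *\<^sub>R \<alpha> i)" 
    using assms unfolding root_cone_def mem_Collect_eq by blast
  also have "\<dots> = (\<Sum>i\<in>I. \<omega> i (\<mu> - \<xi>) *\<^sub>R \<alpha> i)"
    using assms by (intro sum.mono_neutral_right) (auto simp: root_coneD)
  also have "c j \<dots> = (\<Sum>i\<in>I. \<omega> i (\<mu> - \<xi>) * c j (\<alpha> i))"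
    by (simp add: linear_sum[OF linear_c])
  finally show ?thesis .
qed

lemma root_cone_term:
  assumes "\<mu> - \<xi> \<in> root_cone I" "j \<notin> I" "i \<in> I"
  shows "\<omega> i (\<mu> - \<xi>) * c j (\<alpha> i) \<le> 0"
proof -
  have "c j (\<alpha> i) \<le> 0" using assms by (intro c_nonpos) auto
  moreover have "\<omega> i (\<mu> - \<xi>) \<ge> 0" using assms root_coneD by blast
  ultimately show ?thesis by (rule mult_nonneg_nonpos[rotated])
qed

text \<open>For \<open>j\<close> outside \<open>I\<close>, subtracting roots of \<open>I\<close> can
  only raise the pairing with coroot \<open>j\<close>, and any single root bounds the gain from
  below.\<close>

lemma c_root_cone_ge:
  assumes "\<mu> - \<xi> \<in> root_cone I" "j \<notin> I" 
  shows "c j \<xi> \<ge> c j \<mu>" and "i \<in> I \<Longrightarrow> c j \<xi> \<ge> c j \<mu> - \<omega> i (\<mu> - \<xi>) * c j (\<alpha> i)"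
proof -
  note t = root_cone_term[OF assms]
  show "c j \<xi> \<ge> c j \<mu>"
    unfolding c_root_cone[OF assms(1)] using sum_nonpos[OF t] by simp
  have "(\<Sum>i\<in>I - {i}. \<omega> i (\<mu> - \<xi>) * c j (\<alpha> i)) \<le> 0"
    by (rule sum_nonpos) (use t in blast)
  then show "c j \<xi> \<ge> c j \<mu> - \<omega> i (\<mu> - \<xi>) * c j (\<alpha> i)" if "i \<in> I"
    unfolding c_root_cone[OF assms(1)] using that by (simp add: sum.remove)
qed

lemma dom_mono: "I \<subseteq> J \<Longrightarrow> dom J \<subseteq> dom I"
  by (auto simp: dom_def)

lemma orbit_root_cone:
  assumes "\<xi> \<in> orbit I \<mu>" "\<mu> \<in> dom I"
  shows "\<mu> - \<xi> \<in> root_cone I"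
  using assms
proof (induction rule: orbit_descend)
  case base
  show ?case by (simp add: root_cone_0)
next
  case (step \<xi> i)
  have *: "\<mu> - r i \<xi> = (\<mu> - \<xi>) + c i \<xi> *\<^sub>R \<alpha> i" by (simp add: r_def)
  show ?case unfolding * using step by (intro root_cone_add root_cone_scale root_cone_\<alpha>) auto
qed

definition hull_of :: "'n set \<Rightarrow> 'v \<Rightarrow> 'v set" where
  "hull_of I \<mu> = convex hull (orbit I \<mu>)"

lemma orbit_subset_hull: "orbit I \<mu> \<subseteq> hull_of I \<mu>"
  by (simp add: hull_of_def hull_subset)

lemma hull_root_cone:
  assumes "\<xi> \<in> hull_of I \<mu>" "\<mu> \<in> dom I" shows "\<mu> - \<xi> \<in> root_cone I"
proof -
  have "hull_of I \<mu> \<subseteq> {\<xi>. \<mu> - \<xi> \<in> root_cone I}" unfolding hull_of_def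
    by (rule hull_minimal) (use assms orbit_root_cone convex_minus_root_cone in auto)
  then show ?thesis using assms by auto
qed

lemma r_hull: "i \<in> I \<Longrightarrow> \<xi> \<in> hull_of I \<mu> \<Longrightarrow> r i \<xi> \<in> hull_of I \<mu>"
proof -
  assume i: "i \<in> I" and \<xi>: "\<xi> \<in> hull_of I \<mu>"
  have "r i ` hull_of I \<mu> = convex hull (r i ` orbit I \<mu>)"
    unfolding hull_of_def by (rule convex_hull_linear_image[OF linear_r])
  also have "\<dots> \<subseteq> hull_of I \<mu>"
    unfolding hull_of_def by (rule hull_mono) (use orbit_r i in auto)
  finally show ?thesis using \<xi> by auto
qed

text \<open>
  The segment from \<open>v\<close> to \<open>\<xi>\<close> and its mirror image meet on the reflecting hyperplane, so a face
  containing one contains the other.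
\<close>

lemma face_crossing:
  assumes F: "F face_of H" and H: "\<And>x. x \<in> H \<Longrightarrow> r i x \<in> H"
    and "v \<in> F" "\<xi> \<in> F" "c i v < 0" "c i \<xi> > 0"
  shows "r i v \<in> F" "r i \<xi> \<in> F"
proof -
  \<comment> \<open>This \<open>t\<close> solves \<open>c i p = 0\<close>.\<close>
  define t where "t = - c i v / (c i \<xi> - c i v)"
  have t: "0 < t" "t < 1" using assms by (auto simp: t_def field_simps)
  define p where "p = (1 - t) *\<^sub>R v + t *\<^sub>R \<xi>"
  have "c i p = c i v + t * (c i \<xi> - c i v)" by (simp add: p_def algebra_simps)
  also have "\<dots> = 0" using assms by (simp add: t_def)
  finally have "r i p = p" by (simp add: r_def)
  then have p: "p = (1 - t) *\<^sub>R r i v + t *\<^sub>R r i \<xi>"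
    unfolding p_def by (simp add: linear_add[OF linear_r] linear_scale[OF linear_r])
  have "r i v \<noteq> r i \<xi>" using assms by (metis less_asym r_r)
  then have "p \<in> open_segment (r i v) (r i \<xi>)" using t p by (auto simp: in_segment)
  moreover have "p \<in> F" unfolding p_def
    using t assms face_of_imp_convex[OF F] by (intro convexD) auto
  ultimately show "r i v \<in> F" "r i \<xi> \<in> F"
    using face_ofD[OF F] H assms face_of_imp_subset[OF F] by blast+
qed

text \<open>
  This is \<open>\<mu>\<close>-connectedness: a subset \<open>K\<close> of \<open>I\<close> on which \<open>\<mu>\<close> vanishes is never a union of components.
\<close>

definition mu_linked :: "'v \<Rightarrow> 'n set \<Rightarrow> bool" where
  "mu_linked \<mu> I \<longleftrightarrow>
    (\<forall>K. K \<noteq> {} \<longrightarrow> K \<subseteq> I \<longrightarrow> (\<forall>k\<in>K. c k \<mu> = 0) \<longrightarrow> (\<exists>k\<in>K. \<exists>j\<in>I - K. c k (\<alpha> j) \<noteq> 0))"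

text \<open>Coefficients of \<open>\<mu> - \<xi>\<close> never decrease along a descent. Those that
  vanish at its end vanish throughout, so only reflections in \<open>I\<close> occur.\<close>

lemma orbit_of_support:
  assumes "\<xi> \<in> orbit UNIV \<mu>" "\<mu> \<in> dom UNIV" "\<And>i. i \<notin> I \<Longrightarrow> \<omega> i (\<mu> - \<xi>) = 0"
  shows "\<xi> \<in> orbit I \<mu>"
  using assms
proof (induction rule: orbit_descend)
  case base
  show ?case by (rule orbit_self)
next
  case (step \<xi> j)
  have nn: "\<omega> i (\<mu> - \<xi>) \<ge> 0" for i using orbit_\<omega>_nonneg step assms by blast
  have z: "\<omega> i (\<mu> - \<xi>) + (if i = j then c j \<xi> else 0) = 0" if "i \<notin> I" for i
    using step.prems[OF that] unfolding \<omega>_r .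
  have "j \<in> I" using z[of j] nn[of j] step by (auto)
  moreover have "\<omega> i (\<mu> - \<xi>) = 0" if "i \<notin> I" for i using z[OF that] calculation that by (auto split: if_splits)
  ultimately show ?case using step orbit_r by blast
qed

text \<open>The indices not in \<open>S\<close> lie on walls containing \<mu>, so linkage attaches
  one of them, \<open>k\<close>, to some \<open>j\<close> in \<open>S\<close>. A point with positive
  coefficient at \<open>j\<close> then pairs positively with coroot \<open>k\<close>, and reflecting
  it puts \<open>k\<close> into \<open>S\<close>.\<close>

lemma support_orbit:
  assumes "\<mu> \<in> dom UNIV" "mu_linked \<mu> I" "i \<in> I"
  obtains \<xi> where "\<xi> \<in> orbit I \<mu>" "\<omega> i (\<mu> - \<xi>) > 0"
proof -
  have dom: "\<mu> \<in> dom I" using assms(1) dom_mono by blast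
  define S where "S = {i \<in> I. \<exists>\<xi>\<in>orbit I \<mu>. \<omega> i (\<mu> - \<xi>) > 0}"
  have nn: "\<omega> i (\<mu> - \<xi>) \<ge> 0" if "\<xi> \<in> orbit I \<mu>" for i \<xi>
    using orbit_root_cone[OF that dom] root_coneD by blast
  have inS: "k \<in> S" if "k \<in> I" "\<xi> \<in> orbit I \<mu>" "c k \<xi> > 0" for k \<xi>
  proof -
    have "\<omega> k (\<mu> - r k \<xi>) > 0" unfolding \<omega>_r using nn[OF that(2), of k] that by (simp)
    then show ?thesis using that orbit_r unfolding S_def by blast
  qed
  have "I - S = {}"
  proof (rule ccontr)
    assume ne: "I - S \<noteq> {}"
    have "c k \<mu> = 0" if "k \<in> I - S" for k
    proof -
      have "c k \<mu> \<ge> 0" using assms(1) by (simp add: dom_def)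
      then show ?thesis using inS[OF _ orbit_self, of k] that by fastforce
    qed
    then obtain k j where kj: "k \<in> I - S" "j \<in> I - (I - S)" "c k (\<alpha> j) \<noteq> 0" "c k \<mu> = 0"
      using assms(2) ne unfolding mu_linked_def by (metis Diff_subset)
    then obtain \<xi> where \<xi>: "\<xi> \<in> orbit I \<mu>" "\<omega> j (\<mu> - \<xi>) > 0" unfolding S_def by blast
    have "\<omega> i (\<mu> - \<xi>) = 0" if "i \<notin> I - {k}" for i
    proof (cases "i = k")
      case True
      then show ?thesis using nn[OF \<xi>(1), of k] kj \<xi> by (force simp: S_def)
    next
      case False
      then show ?thesis using root_coneD(2)[OF orbit_root_cone[OF \<xi>(1) dom], of i] that by blast
    qed
    then have cone: "\<mu> - \<xi> \<in> root_cone (I - {k})"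
      using orbit_root_cone[OF \<xi>(1) dom] unfolding root_cone_def by blast
    have "j \<noteq> k" using kj by auto
    then have "c k (\<alpha> j) < 0" using kj c_nonpos[of k j] by auto
    then have "0 < c k \<mu> - \<omega> j (\<mu> - \<xi>) * c k (\<alpha> j)" using \<xi> kj by (simp add: mult_pos_neg)
    also have "\<dots> \<le> c k \<xi>" using c_root_cone_ge(2)[OF cone, of k j] kj \<open>j \<noteq> k\<close> by auto
    finally show False using inS \<xi> kj by blast
  qed
  then show ?thesis using that assms(3) unfolding S_def by blast
qed

text \<open>By \<open>support_orbit\<close> and \<open>hull_root_cone\<close>, \<open>I\<close> is
  recovered as the union of the supports of \<open>\<mu> - \<xi>\<close> over the points of the
  hull.\<close>

lemma hull_of_inj:
  assumes "\<mu> \<in> dom UNIV" "mu_linked \<mu> I" "mu_linked \<mu> J" "hull_of I \<mu> = hull_of J \<mu>"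
  shows "I = J"
proof -
  have "I \<subseteq> J" if I: "mu_linked \<mu> I" and eq: "hull_of I \<mu> = hull_of J \<mu>" for I J
  proof
    fix i assume "i \<in> I"
    then obtain \<xi> where "\<xi> \<in> orbit I \<mu>" and pos: "\<omega> i (\<mu> - \<xi>) > 0"
      by (rule support_orbit[OF assms(1) I])
    then have "\<xi> \<in> hull_of J \<mu>" using orbit_subset_hull eq by blast
    then have "\<mu> - \<xi> \<in> root_cone J" using hull_root_cone assms(1) dom_mono by blast
    then show "i \<in> J" using pos root_coneD(2)[of "\<mu> - \<xi>" J i] by fastforce
  qed
  then show ?thesis using assms by blast
qed

lemma face_eq_hull_of:
  assumes \<mu>: "\<mu> \<in> dom UNIV" and F: "F face_of hull_of UNIV \<mu>"
    and \<eta>: "\<eta> \<in> rel_interior F" "\<eta> \<in> dom UNIV"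
  obtains I where "mu_linked \<mu> I" "F = hull_of I \<mu>"
proof -
  have rH: "x \<in> hull_of UNIV \<mu> \<Longrightarrow> r i x \<in> hull_of UNIV \<mu>" for i x by (rule r_hull) auto
  \<comment> \<open>Prolonging the segment from \<open>v\<close> slightly beyond the dominant point
    \<eta> gives a point of \<open>F\<close> strictly on the positive side, so
    \<open>face_crossing\<close> applies.\<close>
  have up: "r i v \<in> F" if "v \<in> F" "c i v < 0" for i v
  proof -
    obtain e where e: "e > 0" "\<eta> + e *\<^sub>R (\<eta> - v) \<in> F" using rel_interior_prolong[OF \<eta>(1) \<open>v \<in> F\<close>] .
    have "c i \<eta> \<ge> 0" using \<eta> by (auto simp: dom_def)
    then have "c i \<eta> + e * (c i \<eta> - c i v) > 0" using e that by (simp add: add_nonneg_pos)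
    then have "c i (\<eta> + e *\<^sub>R (\<eta> - v)) > 0" by simp
    then show ?thesis using face_crossing(1)[OF F rH that(1) e(2) that(2)] by blast
  qed
  have up': "\<xi> \<in> F" if "r i \<xi> \<in> F" "c i \<xi> > 0" for i \<xi>
    using up[OF that(1), of i] that by simp
  have "F \<noteq> {}" using \<eta> rel_interior_subset by blast
  then have "F \<inter> orbit UNIV \<mu> \<noteq> {}"
    using face_of_convex_hull_subset_hull[OF F[unfolded hull_of_def]] by auto
  then obtain v where v: "v \<in> F" "v \<in> orbit UNIV \<mu>" by auto
  \<comment> \<open>A descent from \<mu> to \<open>v\<close> can be traced back inside
    \<open>F\<close> by \<open>up'\<close>.\<close>
  have \<mu>F: "\<mu> \<in> F"
  proof -
    have "v \<in> F \<longrightarrow> \<mu> \<in> F" using v(2) \<mu>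
      by (induction rule: orbit_descend) (use up' in blast)+
    then show ?thesis using v by blast
  qed
  define I where "I = {i. \<exists>\<xi>\<in>F \<inter> orbit UNIV \<mu>. \<omega> i (\<mu> - \<xi>) > 0}"
  have supp: "\<omega> i (\<mu> - \<xi>) = 0" if "\<xi> \<in> F" "\<xi> \<in> orbit UNIV \<mu>" "i \<notin> I" for i \<xi>
    using that orbit_\<omega>_nonneg[OF that(2) \<mu>, of i] unfolding I_def by force
  \<comment> \<open>The coefficient at \<open>i\<close> is zero at \<mu> and positive at \<xi>, so
    some step of the descent reflects in wall \<open>i\<close>. Tracing back to it stays in
    \<open>F\<close>, and that step ends on the negative side.\<close>
  have down: "\<exists>v\<in>F. c i v < 0" if "i \<in> I" for i
  proof -
    obtain \<xi> where \<xi>: "\<xi> \<in> F" "\<xi> \<in> orbit UNIV \<mu>" "\<omega> i (\<mu> - \<xi>) > 0" using \<open>i \<in> I\<close> I_def by blast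
    have "\<xi> \<in> F \<and> \<omega> i (\<mu> - \<xi>) > 0 \<longrightarrow> (\<exists>v\<in>F. c i v < 0)" using \<xi>(2) \<mu>
    proof (induction rule: orbit_descend)
      case base
      show ?case by simp
    next
      case (step \<xi> j)
      show ?case
      proof
        assume *: "r j \<xi> \<in> F \<and> 0 < \<omega> i (\<mu> - r j \<xi>)"
        show "\<exists>v\<in>F. c i v < 0"
        proof (cases "i = j")
          case True
          then show ?thesis using * step by (intro bexI[of _ "r j \<xi>"]) auto
        next
          case False
          then show ?thesis using step * up'[of j \<xi>] unfolding \<omega>_r by simp
        qed
      qed
    qed
    then show ?thesis using \<xi> by blast
  qed
  have stable: "r i v \<in> F" if i: "i \<in> I" and v: "v \<in> F" for i v
  proof -
    obtain \<xi> where \<xi>: "\<xi> \<in> F" "c i \<xi> < 0" using down i by blast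
    consider "c i v < 0" | "c i v = 0" | "c i v > 0" by linarith
    then show ?thesis
    proof cases
      case 1 then show ?thesis using up v by blast
    next
      case 2 then show ?thesis using v by (simp add: r_def)
    next
      case 3 then show ?thesis using face_crossing(2)[OF F rH \<xi>(1) v \<xi>(2)] by blast
    qed
  qed
  have domI: "\<mu> \<in> dom I" using \<mu> dom_mono by blast
  have "orbit I \<mu> \<subseteq> F"
  proof
    fix \<xi> assume "\<xi> \<in> orbit I \<mu>"
    then show "\<xi> \<in> F" using domI by (induction rule: orbit_descend) (use \<mu>F stable in blast)+
  qed
  then have "hull_of I \<mu> \<subseteq> F" unfolding hull_of_def
    using face_of_imp_convex[OF F] by (intro hull_minimal) auto
  moreover have "F \<subseteq> hull_of I \<mu>"
  proof -
    have "F \<subseteq> convex hull (F \<inter> orbit UNIV \<mu>)"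
      by (rule face_of_convex_hull_subset_hull[OF F[unfolded hull_of_def]])
    also have "\<dots> \<subseteq> hull_of I \<mu>" unfolding hull_of_def
      by (rule hull_mono) (use orbit_of_support[OF _ \<mu>] supp in blast)
    finally show ?thesis .
  qed
  moreover have "mu_linked \<mu> I" unfolding mu_linked_def
  proof (intro allI impI)
    fix K assume K: "K \<noteq> {}" "K \<subseteq> I" "\<forall>k\<in>K. c k \<mu> = 0"
    show "\<exists>k\<in>K. \<exists>j\<in>I - K. c k (\<alpha> j) \<noteq> 0"
    proof (rule ccontr)
      assume n: "\<not> ?thesis"
      \<comment> \<open>Without a link from \<open>K\<close> to the rest of \<open>I\<close>, the
        pairings with coroots of \<open>K\<close> stay zero along a descent, so it never reflects in
        \<open>K\<close>. This contradicts the choice of \<open>I\<close>.\<close>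
      have "\<omega> k (\<mu> - \<xi>) = 0" if "\<xi> \<in> orbit I \<mu>" "k \<in> K" for \<xi> k
      proof -
        have "\<forall>k\<in>K. \<omega> k (\<mu> - \<xi>) = 0" using that(1) domI
        proof (induction rule: orbit_descend)
          case base
          show ?case by simp
        next
          case (step \<xi> j)
          have "\<mu> - \<xi> \<in> root_cone I" using step orbit_root_cone domI by blast
          then have "c j \<xi> = c j \<mu> - (\<Sum>i\<in>I. \<omega> i (\<mu> - \<xi>) * c j (\<alpha> i))" by (rule c_root_cone)
          moreover have "(\<Sum>i\<in>I. \<omega> i (\<mu> - \<xi>) * c j (\<alpha> i)) = 0" if "j \<in> K"
            by (rule sum.neutral) (use n that step in auto)
          ultimately have "j \<notin> K" using step K by auto
          then show ?case unfolding \<omega>_r using step by auto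
        qed
        then show ?thesis using that by blast
      qed
      moreover obtain k where k: "k \<in> K" using K by blast
      then obtain \<xi> where "\<xi> \<in> F" "\<xi> \<in> orbit UNIV \<mu>" "\<omega> k (\<mu> - \<xi>) > 0" using K I_def by blast
      moreover have "\<xi> \<in> orbit I \<mu>" using orbit_of_support[OF _ \<mu>] supp calculation by blast
      ultimately show False using k by force
    qed
  qed
  ultimately show ?thesis using that[of I] by blast
qed

end

section \<open>Isotropy groups and stabilizers\<close>

text \<open>Conjugating one factor by \<open>m \<otimes> n\<close> reduces to conjugating it by its
  own component, because the other component commutes with it; this gives normality.\<close>

lemma (in group) internal_direct_product_commutingI:
  assumes K: "subgroup K G" and M: "subgroup M G" and N: "subgroup N G"
    and comm: "\<And>m n. m \<in> M \<Longrightarrow> n \<in> N \<Longrightarrow> m \<otimes> n = n \<otimes> m"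
    and triv: "M \<inter> N = {\<one>}" and gen: "M <#> N = K"
  shows "internal_direct_product G K M N"
proof -
  interpret K: group "G\<lparr>carrier := K\<rparr>" by (rule subgroup.subgroup_is_group[OF K is_group])
  have Mc: "m \<in> carrier G" if "m \<in> M" for m using subgroup.mem_carrier[OF M that] .
  have Nc: "n \<in> carrier G" if "n \<in> N" for n using subgroup.mem_carrier[OF N that] .
  have "m = m \<otimes> \<one>" if "m \<in> M" for m using Mc that by simp
  then have MK: "M \<subseteq> K" unfolding gen[symmetric] set_mult_def using subgroup.one_closed[OF N] by blast
  have "n = \<one> \<otimes> n" if "n \<in> N" for n using Nc that by simp
  then have NK: "N \<subseteq> K" unfolding gen[symmetric] set_mult_def using subgroup.one_closed[OF M] by blast
  have conj: "x \<otimes> h \<otimes> inv x \<in> M" if "x \<in> K" "h \<in> M" for x h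
  proof -
    obtain m n where x: "m \<in> M" "n \<in> N" "x = m \<otimes> n" using \<open>x \<in> K\<close> gen by (auto simp: set_mult_def)
    have "x \<otimes> h \<otimes> inv x = m \<otimes> (n \<otimes> h) \<otimes> inv n \<otimes> inv m"
      using x Mc Nc that by (simp add: inv_mult_group m_assoc)
    also have "n \<otimes> h = h \<otimes> n" using comm[of h n] x that by simp
    also have "m \<otimes> (h \<otimes> n) \<otimes> inv n = m \<otimes> h"
      using x(1,2) Mc Nc that by (simp add: m_assoc)
    finally show ?thesis using x that M by (simp add: subgroup.m_closed subgroup.m_inv_closed)
  qed
  have conj': "x \<otimes> h \<otimes> inv x \<in> N" if "x \<in> K" "h \<in> N" for x h
  proof -
    obtain m n where x: "m \<in> M" "n \<in> N" "x = m \<otimes> n" using \<open>x \<in> K\<close> gen by (auto simp: set_mult_def)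
    then have x': "x = n \<otimes> m" using comm by simp
    have "x \<otimes> h \<otimes> inv x = n \<otimes> (m \<otimes> h) \<otimes> inv m \<otimes> inv n"
      using x(1,2) Mc Nc that unfolding x' by (simp add: inv_mult_group m_assoc)
    also have "m \<otimes> h = h \<otimes> m" using comm[of m h] x that by simp
    also have "n \<otimes> (h \<otimes> m) \<otimes> inv m = n \<otimes> h"
      using x(1,2) Mc Nc that by (simp add: m_assoc)
    finally show ?thesis using x that N by (simp add: subgroup.m_closed subgroup.m_inv_closed)
  qed
  have "M \<lhd> G\<lparr>carrier := K\<rparr>" "N \<lhd> G\<lparr>carrier := K\<rparr>"
    unfolding K.normal_inv_iff using subgroup_incl[OF M K MK] subgroup_incl[OF N K NK] conj conj'
    by (simp_all add: m_inv_consistent[OF K])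
  then show ?thesis using triv gen by (simp add: internal_direct_product_def)
qed

section \<open>The Weyl group inside the general linear group\<close>

lemma GL_simps [simp]: "\<one>\<^bsub>GL\<^esub> = id" "f \<otimes>\<^bsub>GL\<^esub> g = f \<circ> g"
  "f \<in> carrier GL \<longleftrightarrow> linear f \<and> bij f"
  by (simp_all add: GL_def)

lemma group_GL: "group (GL :: ('v::real_vector \<Rightarrow> 'v) monoid)"
proof (rule groupI)
  fix f :: "'v \<Rightarrow> 'v" assume "f \<in> carrier GL"
  then have f: "linear f" "bij f" by auto
  let ?g = "inv_into UNIV f"
  have ff: "f (?g x) = x" "?g (f x) = x" for x
    using f(2) by (simp_all add: bij_is_surj surj_f_inv_f bij_is_inj)
  have "linear ?g"
    by (rule linearI) (metis ff linear_add[OF f(1)], metis ff linear_scale[OF f(1)])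
  moreover have "bij ?g" using f(2) by (rule bij_imp_bij_inv)
  moreover have "?g \<circ> f = id" using ff by (simp add: fun_eq_iff)
  ultimately show "\<exists>g\<in>carrier GL. g \<otimes>\<^bsub>GL\<^esub> f = \<one>\<^bsub>GL\<^esub>" by auto
next
  fix f g h :: "'v \<Rightarrow> 'v"
  show "f \<otimes>\<^bsub>GL\<^esub> g \<otimes>\<^bsub>GL\<^esub> h = f \<otimes>\<^bsub>GL\<^esub> (g \<otimes>\<^bsub>GL\<^esub> h)" by (simp add: fun_eq_iff)
qed (simp_all add: linear_compose bij_comp linear_id)

context cartan_datum
begin

lemma W_UNIV: "w \<in> W I \<Longrightarrow> w \<in> W UNIV"
  using W_mono[of I UNIV] by auto

lemma bij_r: "bij (r i)"
  by (rule o_bij[of "r i"]) auto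

lemma generate_GL: "generate GL (r ` I) = W I"
proof
  interpret GL: group "GL :: ('v \<Rightarrow> 'v) monoid" by (rule group_GL)
  have rGL: "r i \<in> carrier GL" for i by (simp add: linear_r bij_r)
  have inv_r: "inv\<^bsub>GL\<^esub> (r i) = r i" for i
    by (rule GL.inv_equality) (use rGL in auto)
  show "generate GL (r ` I) \<subseteq> W I"
  proof
    fix w assume "w \<in> generate GL (r ` I)"
    then show "w \<in> W I"
    proof (induction rule: generate.induct)
      case (eng u v)
      then show ?case unfolding GL_simps by (intro W_comp)
    qed (auto simp: inv_r W_r W_id simp del: id_apply)
  qed
  show "W I \<subseteq> generate GL (r ` I)"
  proof
    fix w assume "w \<in> W I"
    then obtain xs where xs: "set xs \<subseteq> I" "w = act xs" by (auto simp: W_def)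
    have "act xs \<in> generate GL (r ` I)" using xs(1)
    proof (induction xs)
      case Nil
      show ?case using generate.one[of GL] by (simp add: id_def)
    next
      case (Cons i xs)
      then have "r i \<otimes>\<^bsub>GL\<^esub> act xs \<in> generate GL (r ` I)"
        by (intro generate.eng generate.incl[of "r i"]) auto
      then show ?case by (simp add: o_def)
    qed
    then show "w \<in> generate GL (r ` I)" using xs by simp
  qed
qed

lemma subgroup_W: "subgroup (W I) GL"
proof -
  interpret GL: group "GL :: ('v \<Rightarrow> 'v) monoid" by (rule group_GL)
  show ?thesis unfolding generate_GL[symmetric]
    by (rule GL.generate_is_subgroup) (auto simp: linear_r bij_r)
qed

lemma W_induct [consumes 1, case_names id r]:
  assumes "w \<in> W I" "P id" "\<And>i w. i \<in> I \<Longrightarrow> w \<in> W I \<Longrightarrow> P w \<Longrightarrow> P (r i \<circ> w)"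
  shows "P w"
proof -
  obtain xs where xs: "set xs \<subseteq> I" "w = act xs" using assms by (auto simp: W_def)
  have "P (act xs)" using xs(1)
  proof (induction xs)
    case Nil
    show ?case using assms(2) by (simp add: id_def)
  next
    case (Cons i xs)
    then have "act xs \<in> W I" by (auto simp: W_def)
    then show ?case using assms(3)[of i "act xs"] Cons by (simp add: o_def)
  qed
  then show ?thesis using xs by simp
qed

lemma r_commute_iff:
  assumes "a \<noteq> b"
  shows "r a \<circ> r b = r b \<circ> r a \<longleftrightarrow> c a (\<alpha> b) = 0"
proof
  assume "r a \<circ> r b = r b \<circ> r a"
  \<comment> \<open>At \<open>\<alpha> b\<close> the two sides have coefficients
    \<open>c a (\<alpha> b)\<close> and \<open>- c a (\<alpha> b)\<close> of
    \<open>\<alpha> a\<close>.\<close>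
  then have "r a (r b (\<alpha> b)) = r b (r a (\<alpha> b))" by (simp add: fun_eq_iff)
  then have "\<omega> a (r a (r b (\<alpha> b))) = \<omega> a (r b (r a (\<alpha> b)))" by simp
  then show "c a (\<alpha> b) = 0" using assms by (simp add: r_def linear_diff[OF linear_\<omega>])
next
  assume "c a (\<alpha> b) = 0"
  then show "r a \<circ> r b = r b \<circ> r a" using c_sym by (simp add: fun_eq_iff r_def)
qed

lemma W_commute:
  assumes "\<And>a b. a \<in> J \<Longrightarrow> b \<in> I \<Longrightarrow> r a \<circ> r b = r b \<circ> r a" "u \<in> W J" "v \<in> W I"
  shows "u \<circ> v = v \<circ> u"
proof -
  have comm: "r a (r b \<xi>) = r b (r a \<xi>)" if "a \<in> J" "b \<in> I" for a b \<xi>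
    using assms(1)[OF that] by (metis comp_apply)
  have *: "r a (v \<xi>) = v (r a \<xi>)" if "a \<in> J" for a \<xi>
    using assms(3) by (induction rule: W_induct) (simp_all add: comm that)
  have "u (v \<xi>) = v (u \<xi>)" for \<xi>
    using assms(2) by (induction rule: W_induct) (simp_all add: *)
  then show ?thesis unfolding fun_eq_iff comp_apply by blast
qed

section \<open>Groups fixing or preserving an orbit hull\<close>

text \<open>This is \<open>I_*\<close>, with commuting reflections replaced by vanishing Cartan
  entries; \<open>lower_eq\<close> gives the agreement.\<close>

definition lower :: "'v \<Rightarrow> 'n set \<Rightarrow> 'n set" where
  "lower \<mu> I = {a. c a \<mu> = 0 \<and> a \<notin> I \<and> (\<forall>b\<in>I. c a (\<alpha> b) = 0)}"

lemma lower_eq: "lower \<mu> I = {a \<in> {i. c i \<mu> = 0} - I. \<forall>b\<in>I. r a \<circ> r b = r b \<circ> r a}"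
proof -
  have "(\<forall>b\<in>I. c a (\<alpha> b) = 0) \<longleftrightarrow> (\<forall>b\<in>I. r a \<circ> r b = r b \<circ> r a)" if "a \<notin> I" for a
  proof (intro ball_cong refl)
    fix b assume "b \<in> I"
    then show "c a (\<alpha> b) = 0 \<longleftrightarrow> r a \<circ> r b = r b \<circ> r a" using that r_commute_iff[of a b] by metis
  qed
  then show ?thesis unfolding lower_def by blast
qed

lemma lower_commute: "u \<in> W (lower \<mu> I) \<Longrightarrow> v \<in> W I \<Longrightarrow> u \<circ> v = v \<circ> u"
  by (rule W_commute[of "lower \<mu> I" I]) (auto simp: lower_eq)

text \<open>By \<open>dominant_stabilizer\<close> the stabilizer of this \<eta> is generated by the
  reflections of \<open>lower \<mu> I\<close>, so a single point controls both the stabilizer and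
  the isotropy group of the hull.\<close>

lemma dominant_point_of_hull:
  assumes \<mu>: "\<mu> \<in> dom UNIV" and I: "mu_linked \<mu> I"
  obtains \<eta> where "\<eta> \<in> hull_of I \<mu>" "\<eta> \<in> dom UNIV" "{i. c i \<eta> = 0} = lower \<mu> I"
proof -
  have domI: "\<mu> \<in> dom I" using \<mu> dom_mono by blast
  have "n \<le> card I \<Longrightarrow> \<exists>T \<eta>. T \<subseteq> I \<and> card T = n \<and> \<eta> \<in> hull_of I \<mu> \<and> \<eta> \<in> dom UNIV \<and>
    \<mu> - \<eta> \<in> root_cone T \<and> (\<forall>i\<in>T. c i \<eta> > 0 \<and> \<omega> i (\<mu> - \<eta>) > 0)" for n
  proof (induction n)
    case 0
    have "\<mu> \<in> hull_of I \<mu>" using orbit_self orbit_subset_hull by blast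
    then show ?case using \<mu> root_cone_0
      by (intro exI[of _ "{}"] exI[of _ \<mu>]) auto
  next
    case (Suc n)
    then obtain T \<eta> where T: "T \<subseteq> I" "card T = n" "\<eta> \<in> hull_of I \<mu>" "\<eta> \<in> dom UNIV"
      "\<mu> - \<eta> \<in> root_cone T" "\<forall>i\<in>T. c i \<eta> > 0 \<and> \<omega> i (\<mu> - \<eta>) > 0" by auto
    then have ne: "I - T \<noteq> {}" using Suc.prems by auto
    \<comment> \<open>Either \<mu> is already off the wall of some index outside \<open>T\<close>,
      or linkage attaches such an index to \<open>T\<close>, where the positive coefficients of
      \<open>\<mu> - \<eta>\<close> push \<eta> off its wall.\<close>
    obtain i where i: "i \<in> I - T" "c i \<eta> > 0"
    proof (cases "\<forall>k\<in>I - T. c k \<mu> = 0")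
      case True
      then obtain k j where kj: "k \<in> I - T" "j \<in> T" "c k (\<alpha> j) \<noteq> 0" "c k \<mu> = 0"
        using I ne unfolding mu_linked_def by (metis Diff_subset DiffE DiffI)
      then have "c k (\<alpha> j) < 0" using c_nonpos[of k j] by fastforce
      then have "0 < c k \<mu> - \<omega> j (\<mu> - \<eta>) * c k (\<alpha> j)" using T kj by (simp add: mult_pos_neg)
      also have "\<dots> \<le> c k \<eta>" using c_root_cone_ge(2)[OF T(5), of k j] kj by auto
      finally show ?thesis using that kj by blast
    next
      case False
      then obtain k where k: "k \<in> I - T" "c k \<mu> \<noteq> 0" by blast
      have "c k \<mu> \<ge> 0" using \<mu> by (simp add: dom_def)
      moreover have "c k \<mu> \<le> c k \<eta>" using c_root_cone_ge(1)[OF T(5)] k by simp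
      ultimately show ?thesis using that[of k] k by fastforce
    qed
    \<comment> \<open>Going a quarter of the way to the mirror image stays in the hull and halves
      \<open>c i \<eta>\<close>, so it remains positive while the coefficient at \<open>i\<close>
      becomes positive.\<close>
    define \<eta>' where "\<eta>' = (3/4) *\<^sub>R \<eta> + (1/4) *\<^sub>R r i \<eta>"
    have \<eta>': "\<eta>' = \<eta> - (c i \<eta> / 4) *\<^sub>R \<alpha> i"
      unfolding \<eta>'_def r_def using scaleR_add_left[of "3/4" "1/4" \<eta>] by (simp add: algebra_simps)
    have 1: "\<eta>' \<in> hull_of I \<mu>"
      unfolding \<eta>'_def using T r_hull[of i I \<eta> \<mu>] i
      by (intro convexD[of "hull_of I \<mu>"]) (auto simp: hull_of_def)
    have cge: "c j \<eta>' \<ge> c j \<eta>" if "j \<noteq> i" for j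
      using c_nonpos[OF that] i by (simp add: \<eta>' mult_nonneg_nonpos)
    have ci: "c i \<eta>' > 0" using i by (simp add: \<eta>')
    have 2: "\<eta>' \<in> dom UNIV" unfolding dom_def
    proof safe
      fix j
      have "c j \<eta> \<ge> 0" using T(4) by (simp add: dom_def)
      then show "c j \<eta>' \<ge> 0" using cge[of j] ci by (cases "j = i") auto
    qed
    have diff: "\<mu> - \<eta>' = (\<mu> - \<eta>) + (c i \<eta> / 4) *\<^sub>R \<alpha> i" by (simp add: \<eta>')
    have "\<mu> - \<eta> \<in> root_cone (insert i T)" using T(5) unfolding root_cone_def by blast
    then have 3: "\<mu> - \<eta>' \<in> root_cone (insert i T)" unfolding diff
      using i by (intro root_cone_add root_cone_scale root_cone_\<alpha>) auto
    have "\<omega> j (\<mu> - \<eta>') > 0" if "j \<in> insert i T" for j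
      using that T(6) i root_coneD(1)[OF T(5), of i] unfolding diff by (auto simp: add_nonneg_pos)
    then have 4: "\<forall>j\<in>insert i T. c j \<eta>' > 0 \<and> \<omega> j (\<mu> - \<eta>') > 0"
      using ci cge T(6) i(1) by (fastforce intro: less_le_trans)
    show ?case using 1 2 3 4 T i by (intro exI[of _ "insert i T"] exI[of _ \<eta>']) auto
  qed
  from this[of "card I"] obtain T \<eta> where *: "T \<subseteq> I" "card T = card I" "\<eta> \<in> hull_of I \<mu>"
    "\<eta> \<in> dom UNIV" "\<forall>i\<in>T. c i \<eta> > 0 \<and> \<omega> i (\<mu> - \<eta>) > 0" by auto
  then have "T = I" by (intro card_subset_eq) auto
  with * have \<eta>: "\<And>i. i \<in> I \<Longrightarrow> c i \<eta> > 0" "\<And>i. i \<in> I \<Longrightarrow> \<omega> i (\<mu> - \<eta>) > 0" by auto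
  have cone: "\<mu> - \<eta> \<in> root_cone I" using * hull_root_cone domI by blast
  have "c j \<eta> = 0 \<longleftrightarrow> j \<in> lower \<mu> I" for j
  proof (cases "j \<in> I")
    case True
    then show ?thesis using \<eta>(1)[OF True] by (auto simp: lower_def)
  next
    case False
    have "c j \<mu> \<ge> 0" using \<mu> by (simp add: dom_def)
    \<comment> \<open>All terms are nonpositive and have positive coefficients, so
      \<open>c j \<eta> = 0\<close> forces both \<open>c j \<mu> = 0\<close> and the vanishing of
      all \<open>c j (\<alpha> i)\<close>.\<close>
    moreover have "(\<Sum>i\<in>I. \<omega> i (\<mu> - \<eta>) * c j (\<alpha> i)) \<le> 0"
      using root_cone_term[OF cone False] by (rule sum_nonpos)
    moreover have "(\<Sum>i\<in>I. \<omega> i (\<mu> - \<eta>) * c j (\<alpha> i)) = 0 \<longleftrightarrow> (\<forall>i\<in>I. c j (\<alpha> i) = 0)"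
      using sum_nonneg_eq_0_iff[of I "\<lambda>i. - (\<omega> i (\<mu> - \<eta>) * c j (\<alpha> i))"]
        root_cone_term[OF cone False] \<eta>(2) by (force simp: sum_negf)
    ultimately show ?thesis unfolding c_root_cone[OF cone, of j] lower_def using False by auto
  qed
  then show ?thesis using that * by blast
qed

lemma hull_c_nonneg:
  assumes "\<mu> \<in> dom UNIV" "\<xi> \<in> hull_of I \<mu>" "j \<notin> I" shows "c j \<xi> \<ge> 0"
proof -
  have "\<mu> - \<xi> \<in> root_cone I" using assms hull_root_cone dom_mono by blast
  then have "c j \<mu> \<le> c j \<xi>" using c_root_cone_ge(1) assms(3) by blast
  moreover have "c j \<mu> \<ge> 0" using assms by (simp add: dom_def)
  ultimately show ?thesis by simp
qed

lemma r_lower_fixes: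
  assumes "\<mu> \<in> dom UNIV" "\<xi> \<in> hull_of I \<mu>" "a \<in> lower \<mu> I" shows "r a \<xi> = \<xi>"
proof -
  have "\<mu> - \<xi> \<in> root_cone I" using assms hull_root_cone dom_mono by blast
  then have "c a \<xi> = 0" using assms(3) c_root_cone[of \<mu> \<xi> I a] by (simp add: lower_def)
  then show ?thesis by (simp add: r_def)
qed

lemma W_lower_fixes:
  assumes "\<mu> \<in> dom UNIV" "\<xi> \<in> hull_of I \<mu>" "w \<in> W (lower \<mu> I)" shows "w \<xi> = \<xi>"
  using assms(3) by (induction rule: W_induct) (use r_lower_fixes assms(1,2) in auto)

lemma fixing_hull:
  assumes "\<mu> \<in> dom UNIV" "mu_linked \<mu> I"
  shows "{w \<in> W UNIV. \<forall>\<xi>\<in>hull_of I \<mu>. w \<xi> = \<xi>} = W (lower \<mu> I)"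
proof -
  obtain \<eta> where \<eta>: "\<eta> \<in> hull_of I \<mu>" "\<eta> \<in> dom UNIV" "{i. c i \<eta> = 0} = lower \<mu> I"
    using dominant_point_of_hull[OF assms] .
  have "w \<in> W (lower \<mu> I)" if "w \<in> W UNIV" "w \<eta> = \<eta>" for w
    using dominant_stabilizer[OF that(1) \<eta>(2)] that \<eta> by simp
  then show ?thesis using \<eta>(1) W_lower_fixes[OF assms(1)] W_mono[of "lower \<mu> I" UNIV] by auto
qed

lemma W_image_hull:
  assumes "\<mu> \<in> dom UNIV" "w \<in> W (lower \<mu> I \<union> I)"
  shows "w ` hull_of I \<mu> = hull_of I \<mu>"
proof -
  have stable: "r i \<xi> \<in> hull_of I \<mu>" if "i \<in> lower \<mu> I \<union> I" "\<xi> \<in> hull_of I \<mu>" for i \<xi>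
    using that r_hull r_lower_fixes[OF assms(1)] by auto
  have "r i ` hull_of I \<mu> = hull_of I \<mu>" if "i \<in> lower \<mu> I \<union> I" for i
  proof
    show "hull_of I \<mu> \<subseteq> r i ` hull_of I \<mu>"
      using stable[OF that] by (metis image_eqI r_r subsetI)
  qed (use stable that in auto)
  with assms(2) show ?thesis
    by (induction rule: W_induct) (simp_all only: image_comp[symmetric] image_id id_apply)
qed

lemma W_isotropy_factor:
  assumes "\<mu> \<in> dom UNIV" "mu_linked \<mu> I" "w \<in> W UNIV" "w ` hull_of I \<mu> \<subseteq> hull_of I \<mu>"
  obtains u v where "u \<in> W (lower \<mu> I)" "v \<in> W I" "w = u \<circ> v"
proof -
  obtain \<eta> where \<eta>: "\<eta> \<in> hull_of I \<mu>" "\<eta> \<in> dom UNIV" "{i. c i \<eta> = 0} = lower \<mu> I"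
    using dominant_point_of_hull[OF assms(1,2)] .
  have "\<exists>v. v \<in> W I \<and> (\<forall>v'. v' \<in> W I \<longrightarrow> len UNIV (v \<circ> w) \<le> len UNIV (v' \<circ> w))"
    by (rule ex_has_least_nat[of "\<lambda>v. v \<in> W I", OF W_id])
  \<comment> \<open>Thus \<open>v \<circ> w\<close> is a shortest element of the coset
    \<open>W I w\<close>.\<close>
  then obtain v where v: "v \<in> W I" "\<And>v'. v' \<in> W I \<Longrightarrow> len UNIV (v \<circ> w) \<le> len UNIV (v' \<circ> w)"
    by blast
  have "v \<in> W UNIV" using v(1) by (rule W_UNIV)
  then have vw: "v \<circ> w \<in> W UNIV" using assms(3) by (rule W_comp)
  have "(v \<circ> w) \<eta> \<in> hull_of I \<mu>"
  proof -
    have "v \<in> W (lower \<mu> I \<union> I)" using v(1) W_mono[of I "lower \<mu> I \<union> I"] by blast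
    then have "v ` hull_of I \<mu> = hull_of I \<mu>" by (rule W_image_hull[OF assms(1)])
    moreover have "w \<eta> \<in> hull_of I \<mu>" using \<eta>(1) assms(4) by blast
    ultimately show ?thesis unfolding comp_apply by blast
  qed
  \<comment> \<open>Minimality excludes descents in \<open>I\<close>, so the half-space lemma
    handles these walls; the other walls follow from membership in the hull.\<close>
  moreover have "c i ((v \<circ> w) \<eta>) \<ge> 0" if "i \<in> I" for i
    using half_space[OF vw _ \<eta>(2)] v(2)[OF W_comp[OF W_r[OF that] v(1)]] by (simp add: o_assoc)
  ultimately have "(v \<circ> w) \<eta> \<in> dom UNIV"
    using hull_c_nonneg[OF assms(1)] unfolding dom_def by blast
  then have vw: "v \<circ> w \<in> W (lower \<mu> I)" using dominant_stabilizer[OF vw \<eta>(2)] \<eta> by simp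
  obtain v' where v': "v' \<in> W I" "v' \<circ> v = id" using W_inv[OF v(1)] by metis
  then have "w = v' \<circ> (v \<circ> w)" by (simp add: o_assoc)
  also have "\<dots> = (v \<circ> w) \<circ> v'" using lower_commute[OF vw v'(1)] by simp
  finally show ?thesis using that vw v' by blast
qed

text \<open>The factorization comes from the action on the hull: elements of the left side preserve
  it, and \<open>W_isotropy_factor\<close> splits them.\<close>

lemma W_lower_times:
  assumes "\<mu> \<in> dom UNIV" "mu_linked \<mu> I"
  shows "W (lower \<mu> I \<union> I) = {u \<circ> v | u v. u \<in> W (lower \<mu> I) \<and> v \<in> W I}" (is "?l = ?r")
proof
  show "?r \<subseteq> ?l"
    using W_mono[of "lower \<mu> I" "lower \<mu> I \<union> I"] W_mono[of I "lower \<mu> I \<union> I"]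
    by (auto intro!: W_comp)
  show "?l \<subseteq> ?r"
  proof
    fix w assume w: "w \<in> ?l"
    have "w \<in> W UNIV" using w by (rule W_UNIV)
    moreover have "w ` hull_of I \<mu> \<subseteq> hull_of I \<mu>" using W_image_hull[OF assms(1) w] by simp
    ultimately obtain u v where "u \<in> W (lower \<mu> I)" "v \<in> W I" "w = u \<circ> v"
      by (rule W_isotropy_factor[OF assms])
    then show "w \<in> ?r" by blast
  qed
qed

lemma isotropy_hull:
  assumes "\<mu> \<in> dom UNIV" "mu_linked \<mu> I"
  shows "{w \<in> W UNIV. w ` hull_of I \<mu> = hull_of I \<mu>} = W (lower \<mu> I \<union> I)"
proof
  show "{w \<in> W UNIV. w ` hull_of I \<mu> = hull_of I \<mu>} \<subseteq> W (lower \<mu> I \<union> I)"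
  proof
    fix w assume "w \<in> {w \<in> W UNIV. w ` hull_of I \<mu> = hull_of I \<mu>}"
    then have "w \<in> W UNIV" "w ` hull_of I \<mu> \<subseteq> hull_of I \<mu>" by auto
    then obtain u v where "u \<in> W (lower \<mu> I)" "v \<in> W I" "w = u \<circ> v"
      by (rule W_isotropy_factor[OF assms])
    then show "w \<in> W (lower \<mu> I \<union> I)" unfolding W_lower_times[OF assms] by blast
  qed
  show "W (lower \<mu> I \<union> I) \<subseteq> {w \<in> W UNIV. w ` hull_of I \<mu> = hull_of I \<mu>}"
    using W_image_hull[OF assms(1)] W_UNIV by blast
qed

text \<open>A common element fixes the point \<eta> of \<open>dominant_point_of_hull\<close>. That
  point lies on no wall of \<open>I\<close>, so its stabilizer in \<open>W I\<close> is
  trivial.\<close>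

lemma W_lower_Int:
  assumes "\<mu> \<in> dom UNIV" "mu_linked \<mu> I"
  shows "W (lower \<mu> I) \<inter> W I = {id}"
proof -
  obtain \<eta> where \<eta>: "\<eta> \<in> hull_of I \<mu>" "\<eta> \<in> dom UNIV" "{i. c i \<eta> = 0} = lower \<mu> I"
    using dominant_point_of_hull[OF assms] .
  have "w = id" if w: "w \<in> W (lower \<mu> I)" "w \<in> W I" for w
  proof -
    have "\<eta> \<in> dom I" using \<eta> dom_mono by blast
    moreover have "w \<eta> = \<eta>" using W_lower_fixes[OF assms(1) \<eta>(1) w(1)] .
    ultimately have "w \<in> W {i \<in> I. c i \<eta> = 0}" using dominant_stabilizer[OF w(2)] by auto
    moreover have "{i \<in> I. c i \<eta> = 0} = {}" using \<eta>(3) by (auto simp: lower_def)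
    ultimately show ?thesis by simp
  qed
  then show ?thesis using W_id by auto
qed

lemma internal_direct_product_W:
  assumes "\<mu> \<in> dom UNIV" "mu_linked \<mu> I"
  shows "internal_direct_product GL (W (lower \<mu> I \<union> I)) (W (lower \<mu> I)) (W I)"
proof -
  interpret GL: group "GL :: ('v \<Rightarrow> 'v) monoid" by (rule group_GL)
  show ?thesis
  proof (rule GL.internal_direct_product_commutingI[OF subgroup_W subgroup_W subgroup_W])
    show "u \<otimes>\<^bsub>GL\<^esub> v = v \<otimes>\<^bsub>GL\<^esub> u" if "u \<in> W (lower \<mu> I)" "v \<in> W I" for u v
      using lower_commute[OF that] by simp
    show "W (lower \<mu> I) \<inter> W I = {\<one>\<^bsub>GL\<^esub>}"
      using W_lower_Int[OF assms] by simp
    show "W (lower \<mu> I) <#>\<^bsub>GL\<^esub> W I = W (lower \<mu> I \<union> I)"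
      unfolding W_lower_times[OF assms] by (auto simp: set_mult_def)
  qed
qed

text \<open>Elements of \<open>W J\<close> move points only along roots of \<open>J\<close>, whereas
  \<open>r i\<close> moves \<open>\<alpha> i\<close> by twice itself.\<close>

lemma r_in_W_iff: "r i \<in> W J \<longleftrightarrow> i \<in> J"
proof
  assume "r i \<in> W J"
  have "\<alpha> i - r i (\<alpha> i) = 2 *\<^sub>R \<alpha> i" by (simp add: r_def)
  moreover have "\<forall>j. j \<notin> J \<longrightarrow> \<omega> j (\<xi> - r i \<xi>) = 0" for \<xi>
    using \<open>r i \<in> W J\<close>
  proof (induction rule: W_induct)
    case id
    then show ?case by simp
  next
    case (r j w)
    then show ?case using \<omega>_r[of _ \<xi> j "w \<xi>"] by auto
  qed
  ultimately have "i \<notin> J \<longrightarrow> \<omega> i (2 *\<^sub>R \<alpha> i) = 0" by metis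
  then show "i \<in> J" by auto
qed (rule W_r)

end

section \<open>Transfer to realizations of Cartan matrices\<close>

text \<open>The functionals \<omega> extend the coordinates dual to the independent simple roots
  linearly to the whole space.\<close>

lemma realization_cartan_datum:
  assumes "gen_cartan_matrix A" "realization A \<alpha> \<alpha>v"
  obtains \<omega> where "cartan_datum \<alpha> (\<lambda>i \<eta>. blinfun_apply \<eta> (\<alpha>v i)) \<omega>"
proof -
  have A: "A $ i $ i = 2" "i \<noteq> j \<Longrightarrow> A $ i $ j \<le> 0" "A $ i $ j = 0 \<Longrightarrow> A $ j $ i = 0" for i j
    using assms(1) by (auto simp: gen_cartan_matrix_def)
  have c: "blinfun_apply (\<alpha> j) (\<alpha>v i) = real_of_int (A $ i $ j)" for i j
    using assms(2) by (simp add: realization_def)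
  have inj: "inj \<alpha>" and ind: "independent (range \<alpha>)"
    using assms(2) by (simp_all add: realization_def)
  have "\<exists>g :: _ \<Rightarrow> real. linear g \<and> (\<forall>x\<in>range \<alpha>. g x = (if x = \<alpha> i then 1 else 0))" for i
    using linear_independent_extend[OF ind] .
  then obtain \<omega> :: "_ \<Rightarrow> _ \<Rightarrow> real" where \<omega>: "linear (\<omega> i)" "\<forall>x\<in>range \<alpha>. \<omega> i x = (if x = \<alpha> i then 1 else 0)" for i
    by metis
  have "cartan_datum \<alpha> (\<lambda>i \<eta>. blinfun_apply \<eta> (\<alpha>v i)) \<omega>"
  proof (intro cartan_datum.intro)
    show "linear (\<lambda>\<eta>. blinfun_apply \<eta> (\<alpha>v i))" for i
      by (rule linearI) (auto simp: blinfun.add_left blinfun.scaleR_left)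
    show "\<omega> i (\<alpha> j) = (if i = j then 1 else 0)" for i j
      using \<omega>(2)[of i] inj by (auto simp: inj_def)
  qed (use A \<omega> in \<open>auto simp: c\<close>)
  then show ?thesis using that by blast
qed

text \<open>A set \<open>K\<close> violating linkage is closed under adjacency in \<open>I\<close>,
  so it contains a whole component. Conversely, a component inside \<open>J0\<close> is itself such
  a set.\<close>

lemma mu_connected_iff_mu_linked:
  assumes "cartan_datum \<alpha> (\<lambda>i \<eta>. blinfun_apply \<eta> (\<alpha>v i)) \<omega>"
  shows "mu_connected \<alpha> \<alpha>v \<mu> I \<longleftrightarrow> cartan_datum.mu_linked \<alpha> (\<lambda>i \<eta>. blinfun_apply \<eta> (\<alpha>v i)) \<mu> I"
proof -
  interpret cartan_datum \<alpha> "\<lambda>i \<eta>. blinfun_apply \<eta> (\<alpha>v i)" \<omega> by fact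
  let ?R = "{(a, b). a \<in> I \<and> b \<in> I \<and> adjacent \<alpha> \<alpha>v a b}"
  have adj: "adjacent \<alpha> \<alpha>v a b \<longleftrightarrow> a \<noteq> b \<and> blinfun_apply (\<alpha> b) (\<alpha>v a) \<noteq> 0" for a b
    unfolding adjacent_def using c_sym by blast
  show ?thesis
  proof
    assume conn: "mu_connected \<alpha> \<alpha>v \<mu> I"
    show "mu_linked \<mu> I" unfolding mu_linked_def
    proof (intro allI impI)
      fix K assume K: "K \<noteq> {}" "K \<subseteq> I" "\<forall>k\<in>K. blinfun_apply \<mu> (\<alpha>v k) = 0"
      show "\<exists>k\<in>K. \<exists>j\<in>I - K. blinfun_apply (\<alpha> j) (\<alpha>v k) \<noteq> 0"
      proof (rule ccontr)
        assume n: "\<not> ?thesis"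
        obtain i where i: "i \<in> K" using K by blast
        have "j \<in> K" if "(i, j) \<in> ?R\<^sup>*" for j
          using that
        proof (induction rule: rtrancl_induct)
          case (step a b)
          then have "b \<in> I" "blinfun_apply (\<alpha> b) (\<alpha>v a) \<noteq> 0" using adj by auto
          then show ?case using n step.IH by blast
        qed (rule i)
        then have "{j. (i, j) \<in> ?R\<^sup>*} \<subseteq> J0 \<alpha>v \<mu>" using K by (auto simp: J0_def)
        moreover have "{j. (i, j) \<in> ?R\<^sup>*} \<in> dynkin_components \<alpha> \<alpha>v I"
          using i K by (auto simp: dynkin_components_def)
        ultimately show False using conn by (auto simp: mu_connected_def)
      qed
    qed
  next
    assume closed: "mu_linked \<mu> I"
    show "mu_connected \<alpha> \<alpha>v \<mu> I" unfolding mu_connected_def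
    proof (intro ballI notI)
      fix K assume "K \<in> dynkin_components \<alpha> \<alpha>v I" and J0: "K \<subseteq> J0 \<alpha>v \<mu>"
      then obtain i where i: "i \<in> I" "K = {j. (i, j) \<in> ?R\<^sup>*}" unfolding dynkin_components_def by blast
      have "j \<in> I" if "(i, j) \<in> ?R\<^sup>*" for j
        using that
      proof (induction rule: rtrancl_induct)
        case (step a b)
        then show ?case by blast
      qed (rule i(1))
      then have "K \<subseteq> I" unfolding i(2) by blast
      moreover have "i \<in> K" unfolding i(2) by blast
      then have "K \<noteq> {}" by blast
      moreover have "\<forall>k\<in>K. blinfun_apply \<mu> (\<alpha>v k) = 0" using J0 by (auto simp: J0_def)
      ultimately obtain k j where kj: "k \<in> K" "j \<in> I - K" "blinfun_apply (\<alpha> j) (\<alpha>v k) \<noteq> 0"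
        using closed[unfolded mu_linked_def, rule_format, of K] by blast
      then have "(k, j) \<in> ?R" using \<open>K \<subseteq> I\<close> adj by auto
      moreover have "(i, k) \<in> ?R\<^sup>*" using kj(1) unfolding i(2) by blast
      ultimately have "j \<in> K" unfolding i(2) by (blast intro: rtrancl_into_rtrancl)
      then show False using kj by blast
    qed
  qed
qed

theorem theorem3p15:
  fixes A :: "int ^ 'n ^ 'n"
    and \<alpha> :: "'n \<Rightarrow> ('h::euclidean_space \<Rightarrow>\<^sub>L real)"
    and \<alpha>v :: "'n \<Rightarrow> 'h"
    and \<mu> :: "'h \<Rightarrow>\<^sub>L real"
    and F :: "('h \<Rightarrow>\<^sub>L real) set"
  assumes "gen_cartan_matrix A"
    and "realization A \<alpha> \<alpha>v"
    and "\<mu> \<in> chamber \<alpha>v"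
    and "fundamental_face \<alpha> \<alpha>v \<mu> F"
  shows "face_stabilizer \<alpha> \<alpha>v F = parabolic \<alpha> \<alpha>v (lambda_low \<alpha> \<alpha>v \<mu> F)
    \<and> isotropy_group \<alpha> \<alpha>v F = parabolic \<alpha> \<alpha>v (lambda \<alpha> \<alpha>v \<mu> F)
    \<and> internal_direct_product GL (parabolic \<alpha> \<alpha>v (lambda \<alpha> \<alpha>v \<mu> F))
         (parabolic \<alpha> \<alpha>v (lambda_low \<alpha> \<alpha>v \<mu> F)) (parabolic \<alpha> \<alpha>v (lambda_up \<alpha> \<alpha>v \<mu> F))
    \<and> lambda_low \<alpha> \<alpha>v \<mu> F = {i. \<forall>\<eta> \<in> F. simple_reflection \<alpha> \<alpha>v i \<eta> = \<eta>}
    \<and> lambda \<alpha> \<alpha>v \<mu> F = {i. simple_reflection \<alpha> \<alpha>v i ` F = F}"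
proof -
  obtain \<omega> where datum: "cartan_datum \<alpha> (\<lambda>i \<eta>. blinfun_apply \<eta> (\<alpha>v i)) \<omega>"
    using realization_cartan_datum[OF assms(1,2)] .
  interpret cartan_datum \<alpha> "\<lambda>i \<eta>. blinfun_apply \<eta> (\<alpha>v i)" \<omega> by fact
  note conn_iff = mu_connected_iff_mu_linked[OF datum]
  have refl: "simple_reflection \<alpha> \<alpha>v = r"
    by (simp add: fun_eq_iff simple_reflection_def r_def)
  have par: "parabolic \<alpha> \<alpha>v J = W J" for J
    by (simp add: parabolic_def refl generate_GL)
  have hull: "orbit_hull \<alpha> \<alpha>v \<mu> J = hull_of J \<mu>" for J
    by (simp add: orbit_hull_def hull_of_def orbit_def par)
  have whull: "weyl_hull \<alpha> \<alpha>v \<mu> = hull_of UNIV \<mu>"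
    by (simp add: weyl_hull_def hull_of_def orbit_def par weyl_group_def)
  have chamber: "chamber \<alpha>v = dom UNIV"
    by (simp add: chamber_def dom_def)
  have \<mu>: "\<mu> \<in> dom UNIV" using assms(3) chamber by simp
  have stab: "face_stabilizer \<alpha> \<alpha>v F = {w \<in> W UNIV. \<forall>\<eta>\<in>F. w \<eta> = \<eta>}"
    and iso: "isotropy_group \<alpha> \<alpha>v F = {w \<in> W UNIV. w ` F = F}"
    by (simp_all add: face_stabilizer_def isotropy_group_def weyl_group_def par)
  show ?thesis
  proof (cases "F = {}")
    case True
    interpret GL: group "GL :: (('h \<Rightarrow>\<^sub>L real) \<Rightarrow> _) monoid" by (rule group_GL)
    \<comment> \<open>Everything fixes the empty face, so the first factor is the whole group and
      the second is trivial.\<close>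
    have "internal_direct_product GL (W UNIV) (W UNIV) (W {})"
      by (rule GL.internal_direct_product_commutingI[OF subgroup_W subgroup_W subgroup_W])
        (use W_id in \<open>auto simp: set_mult_def\<close>)
    then show ?thesis
      unfolding stab iso using True by (simp add: par lambda_def lambda_low_def lambda_up_def del: W_empty)
  next
    case False
    then obtain \<eta> where \<eta>: "F face_of hull_of UNIV \<mu>" "\<eta> \<in> rel_interior F" "\<eta> \<in> dom UNIV"
      using assms(4) by (auto simp: fundamental_face_def whull chamber)
    obtain I where I: "mu_linked \<mu> I" "F = hull_of I \<mu>"
      using face_eq_hull_of[OF \<mu> \<eta>] .
    have "(THE J. mu_connected \<alpha> \<alpha>v \<mu> J \<and> F = orbit_hull \<alpha> \<alpha>v \<mu> J) = I"
      using I hull_of_inj[OF \<mu>] by (intro the_equality) (auto simp: conn_iff hull)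
    then have up: "lambda_up \<alpha> \<alpha>v \<mu> F = I" using False by (simp add: lambda_up_def)
    then have low: "lambda_low \<alpha> \<alpha>v \<mu> F = lower \<mu> I"
      using False by (simp add: lambda_low_def lower_star_def lower_eq refl J0_def)
    have S: "face_stabilizer \<alpha> \<alpha>v F = W (lower \<mu> I)"
      using fixing_hull[OF \<mu> I(1)] stab I(2) by simp
    have T: "isotropy_group \<alpha> \<alpha>v F = W (lower \<mu> I \<union> I)"
      using isotropy_hull[OF \<mu> I(1)] iso I(2) by simp
    have rU: "r i \<in> W UNIV" for i by (rule W_r) simp
    \<comment> \<open>The descriptions of the index sets follow by testing the group equalities on
      simple reflections.\<close>
    have "i \<in> lower \<mu> I \<longleftrightarrow> (\<forall>\<eta>\<in>F. r i \<eta> = \<eta>)" for i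
      using r_in_W_iff[of i "lower \<mu> I"] rU[of i] unfolding S[symmetric] stab by simp
    moreover have "i \<in> lower \<mu> I \<union> I \<longleftrightarrow> r i ` F = F" for i
      using r_in_W_iff[of i "lower \<mu> I \<union> I"] rU[of i] unfolding T[symmetric] iso by simp
    ultimately have "lower \<mu> I = {i. \<forall>\<eta>\<in>F. r i \<eta> = \<eta>}" "lower \<mu> I \<union> I = {i. r i ` F = F}"
      by blast+
    then show ?thesis
      using internal_direct_product_W[OF \<mu> I(1)] S T unfolding lambda_def up low par refl by blast
  qed
qed

end
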